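(* Let $k_1,k_2,k_3,k_4,k_5>0$ be arbitrary control gains. Consider the system (with inputs $v,q,r$, where $r=\tilde r\cos\theta$) $$\begin{aligned} \dot\rho&=v(\sin\theta\sin\zeta-\cos\theta\cos\zeta\cos\gamma),\\ \dot\delta&=\frac{v\cos\theta}{\rho\cos\zeta}\sin\gamma,\\ \dot\gamma&=\frac{v\cos\theta}{\rho\cos\zeta}\sin\gamma-\tilde r,\\ \dot\zeta&=\frac{v}{\rho}(\cos\theta\sin\zeta\cos\gamma+\sin\theta\cos\zeta),\\ \dot\theta&=q, \end{aligned}$$ with state $\Theta=(\rho,\delta,\gamma,\zeta,\theta)^\top$ on $\mathcal D=\{\rho>0\}\times\mathcal T$, $\mathcal T=\{(\delta,\gamma,\zeta,\theta)\in\mathbb R^4:|\zeta|<\pi/2\}$. With $e_1,e_2,N,B,C,\sigma_1,\sigma_2$ as defined in the context, the forward surge velocity input $$v=k_1\rho NB,$$ the pitch rate input $$\begin{aligned} q=&-k_5e_2+k_1k_2\delta^2\sigma_2(e_2,\theta)B\\ &+\frac{k_1}{N^2B}\Bigl[k_2^2\delta\cos\theta\cos\zeta\sin\gamma\,(k_3\sin\zeta+\tan\zeta)-(\cos\theta\sin\zeta\cos\gamma+\sin\theta\cos\zeta)\,C\Bigr]\\ &-k_1\rho^2B\bigl(\sin\zeta\,\sigma_1(e_2,\theta)N-\cos\zeta\,\sigma_2(e_2,\theta)\bigr)\\ &-\frac{k_1\tan\zeta\,B}{\cos^2\zeta}\bigl(\sin\zeta\,\sigma_2(e_2,\theta)+\cos\zeta\,\sigma_1(e_2,\theta)N\bigr),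 \end{aligned}$$ and the yaw rate input $r=\tilde r\cos\theta$ with $$\begin{aligned} \tilde r=&\;k_4e_1+\frac{k_1NB}{\cos\zeta}\cos\theta\sin\gamma\\ &+\frac{k_1k_2B}{N}\Bigl[\cos\theta\sin\gamma-\delta\Bigl(\cos\theta\sin^2\zeta\cos\gamma+\frac{\sin\theta\sin(2\zeta)}{2}\Bigr)\Bigr]\\ &-k_1\rho^2\cos\zeta\,N\bigl(\sigma_2(e_1,\gamma)+e_2\sigma_2(e_1,\gamma)\sigma_2(e_2,\theta)B\bigr)\\ &+\frac{k_1\delta\,\sigma_1(e_1,\gamma)N}{\cos\zeta}\bigl(1+e_2\sigma_2(e_2,\theta)B\bigr)\\ &+\frac{k_1\tan\zeta\,N}{\cos^2\zeta}\sin\zeta\,\bigl(\sigma_2(e_1,\gamma)+e_2\sigma_2(e_1,\gamma)\sigma_2(e_2,\theta)B\bigr), \end{aligned}$$ renders the point $\Theta=0$ globally exponentially stable (GES) on $\mathcal D$ for the closed-loop system, in the sense defined in the context. Moreover, the function $$V(\Theta)=\tfrac12\bigl(\rho^2+\delta^2+\tan^2\zeta+e_1^2+e_2^2\bigr)$$ is a strict control Lyapunov function (CLF) for the system, in the sense defined in the context.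
   Context: Backstepping variables: $$\eta(\delta,\zeta)=\frac{k_3\sin\zeta+\tan\zeta}{\sqrt{1+k_2^2\delta^2\cos^2\zeta}},\qquad e_1=\gamma+\arctan(k_2\delta\cos\zeta),\qquad e_2=\theta+\arctan(\eta(\delta,\zeta)).$$ Auxiliary functions of $(\delta,\zeta)$ (arguments suppressed in the claim): $$N=\sqrt{1+k_2^2\delta^2\cos^2\zeta},\qquad B=\sqrt{1+\eta^2(\delta,\zeta)},$$ $$C=1+k_3\cos\zeta+\tan^2\zeta+k_2^2\delta^2\bigl(2+k_3\cos\zeta-\cos^2\zeta\bigr).$$ Auxiliary functions: $$\sigma_1(a,b)=\frac{\sin(a-b)+\sin b}{a},\qquad \sigma_2(a,b)=\frac{\partial\sigma_1(a,b)}{\partial b}=\frac{\cos b-\cos(a-b)}{a},$$ extended continuously at $a=0$ by $\sigma_1(0,b)=\cos b$, $\sigma_2(0,b)=-\sin b$. Metric: $|\Theta|_{\mathcal D}=\rho+|\delta|+|\gamma|+|\tan\zeta|+|\theta|$. GES on $\mathcal D$: for the system with a feedback law $v,q,r$ that is continuous on the state space $\mathcal D$ with respect to its metric, the point $\Theta=0$ is GES on $\mathcal D$ if there exist $K\ge1$ and $\lambda>0$ such that every closed-loop solution starting in $\mathcal D$ at time $t_0$ satisfies, for all $t\ge t_0$, $|\Theta(t)|_{\mathcal D}\le K|\Theta(t_0)|_{\mathcal D}e^{-\lambda(t-t_0)}$. (The point $\Theta=0$ itself has $\rho=0$ and lies on the boundary of $\mathcal D$.) Strict CLF: let $\Sigma=\{\rho\ge0\}\times\mathcal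 T$. A continuously differentiable function $\Theta\mapsto V(\Theta)$ is a (strict) CLF for the system if (i) there exist class $\mathcal K$ functions $\bar\alpha_1,\bar\alpha_2$ such that $\bar\alpha_1(|\Theta|_{\mathcal D})\le V(\Theta)\le\bar\alpha_2(|\Theta|_{\mathcal D})$ for all $\Theta\in\Sigma$; and (ii) for every $\Theta\ne0$ in $\Sigma$ there exists $\bigl(\frac v\rho,q,\frac r{\cos\theta}\bigr)\in\mathbb R^3$ such that $\dot V(\Theta)<0$. Here $\dot V$ is the derivative of $V$ along the system, in which $\frac v\rho$, $q$ and $\frac{r}{\cos\theta}=\tilde r$ are regarded as the three free real input values (so the right-hand side is defined also at $\rho=0$, with $v=\rho\cdot\frac v\rho$). *)

theory Defs
  imports "HOL-Analysis.Analysis"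
begin

type_synonym state = "real \<times> real \<times> real \<times> real \<times> real"

text \<open>States are tuples \<open>(\<rho>, \<delta>, \<gamma>, \<zeta>, \<theta>)\<close>.\<close>

definition state_D :: "state set" where
  "state_D = {(\<rho>, \<delta>, \<gamma>, \<zeta>, \<theta>). \<rho> > 0 \<and> \<bar>\<zeta>\<bar> < pi / 2}"

definition state_Sigma :: "state set" where
  "state_Sigma = {(\<rho>, \<delta>, \<gamma>, \<zeta>, \<theta>). \<rho> \<ge> 0 \<and> \<bar>\<zeta>\<bar> < pi / 2}"

fun size_D :: "state \<Rightarrow> real" where
  "size_D (\<rho>, \<delta>, \<gamma>, \<zeta>, \<theta>) = \<rho> + \<bar>\<delta>\<bar> + \<bar>\<gamma>\<bar> + \<bar>tan \<zeta>\<bar> + \<bar>\<theta>\<bar>"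

text \<open>The metric for which \<^const>\<open>size_D\<close> is the distance to the origin.\<close>

fun dist_D :: "state \<Rightarrow> state \<Rightarrow> real" where
  "dist_D (\<rho>, \<delta>, \<gamma>, \<zeta>, \<theta>) (\<rho>', \<delta>', \<gamma>', \<zeta>', \<theta>') =
     \<bar>\<rho> - \<rho>'\<bar> + \<bar>\<delta> - \<delta>'\<bar> + \<bar>\<gamma> - \<gamma>'\<bar> + \<bar>tan \<zeta> - tan \<zeta>'\<bar> + \<bar>\<theta> - \<theta>'\<bar>"

lemma tan_inj_strip:
  assumes "\<bar>x\<bar> < pi / 2" "\<bar>y\<bar> < pi / 2" "tan x = tan y"
  shows "x = y"
proof -
  have "arctan (tan x) = x" "arctan (tan y) = y"
    using assms by (intro arctan_tan; simp add: abs_less_iff)+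
  then show ?thesis using assms(3) by metis
qed

lemma Metric_space_D: "Metric_space state_D dist_D"
proof
  fix a b c :: state
  obtain a1 a2 a3 a4 a5 where a: "a = (a1, a2, a3, a4, a5)" by (cases a)
  obtain b1 b2 b3 b4 b5 where b: "b = (b1, b2, b3, b4, b5)" by (cases b)
  obtain c1 c2 c3 c4 c5 where c: "c = (c1, c2, c3, c4, c5)" by (cases c)
  show "0 \<le> dist_D a b" unfolding a b dist_D.simps by (intro add_nonneg_nonneg abs_ge_zero)
  show "dist_D a b = dist_D b a" by (simp only: a b dist_D.simps abs_minus_commute)
  have tri: "\<bar>x - z\<bar> \<le> \<bar>x - y\<bar> + \<bar>y - z\<bar>" for x y z :: real by arith
  show "dist_D a c \<le> dist_D a b + dist_D b c"
    using add_mono[OF add_mono[OF add_mono[OF add_mono[OF tri[of a1 c1 b1] tri[of a2 c2 b2]]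
      tri[of a3 c3 b3]] tri[of "tan a4" "tan c4" "tan b4"]] tri[of a5 c5 b5]]
    by (simp only: a b c dist_D.simps ac_simps)
  assume "a \<in> state_D" "b \<in> state_D"
  then have z: "\<bar>a4\<bar> < pi / 2" "\<bar>b4\<bar> < pi / 2" by (auto simp: state_D_def a b)
  show "dist_D a b = 0 \<longleftrightarrow> a = b"
  proof
    assume "dist_D a b = 0"
    then have "a1 = b1 \<and> a2 = b2 \<and> a3 = b3 \<and> tan a4 = tan b4 \<and> a5 = b5"
      by (simp add: a b add_nonneg_eq_0_iff)
    then show "a = b" using tan_inj_strip[OF z] by (simp add: a b)
  next
    assume "a = b"
    then show "dist_D a b = 0" by (simp add: a b)
  qed
qed

lemma size_D_eq_dist:
  assumes "x \<in> state_Sigma"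
  shows "size_D x = dist_D x 0"
proof -
  obtain a b c d e where x: "x = (a, b, c, d, e)" by (cases x)
  have "a \<ge> 0" using assms by (simp add: x state_Sigma_def)
  then show ?thesis by (simp only: x zero_prod_def size_D.simps dist_D.simps diff_0_right tan_zero abs_of_nonneg)
qed

text \<open>The system. The third input is \<open>rt\<close>, with \<open>r = rt * cos \<theta>\<close>: the yaw rate enters the
  equations only through \<open>rt\<close>, which \<open>r\<close> does not determine where \<open>cos \<theta> = 0\<close>.\<close>

fun sys_rhs :: "real \<Rightarrow> real \<Rightarrow> real \<Rightarrow> state \<Rightarrow> state" where
  "sys_rhs v q rt (\<rho>, \<delta>, \<gamma>, \<zeta>, \<theta>) =
     (v * (sin \<theta> * sin \<zeta> - cos \<theta> * cos \<zeta> * cos \<gamma>),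
      v * cos \<theta> / (\<rho> * cos \<zeta>) * sin \<gamma>,
      v * cos \<theta> / (\<rho> * cos \<zeta>) * sin \<gamma> - rt,
      v / \<rho> * (cos \<theta> * sin \<zeta> * cos \<gamma> + sin \<theta> * cos \<zeta>),
      q)"

text \<open>The same system with \<open>u = v / \<rho>\<close> as the first input, meaningful also at \<open>\<rho> = 0\<close>.\<close>

fun sys_rhs_ext :: "real \<Rightarrow> real \<Rightarrow> real \<Rightarrow> state \<Rightarrow> state" where
  "sys_rhs_ext u q rt (\<rho>, \<delta>, \<gamma>, \<zeta>, \<theta>) =
     (\<rho> * u * (sin \<theta> * sin \<zeta> - cos \<theta> * cos \<zeta> * cos \<gamma>),
      u * cos \<theta> / cos \<zeta> * sin \<gamma>,
      u * cos \<theta> / cos \<zeta> * sin \<gamma> - rt,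
      u * (cos \<theta> * sin \<zeta> * cos \<gamma> + sin \<theta> * cos \<zeta>),
      q)"

lemma sys_rhs_eq_ext:
  assumes "fst \<Theta> \<noteq> 0"
  shows "sys_rhs v q rt \<Theta> = sys_rhs_ext (v / fst \<Theta>) q rt \<Theta>"
  using assms by (cases \<Theta>) simp

text \<open>Forward solutions on an interval \<open>J\<close> with left endpoint \<open>t0\<close>. The degenerate interval
  \<open>J = {t0}\<close> is allowed, so by Zorn's lemma every initial state in \<open>D\<close> starts some maximal solution.\<close>

definition solution_on ::
  "(state \<Rightarrow> state) \<Rightarrow> state set \<Rightarrow> real \<Rightarrow> real set \<Rightarrow> (real \<Rightarrow> state) \<Rightarrow> bool" where
  "solution_on f D t0 J x \<longleftrightarrow>
     is_interval J \<and> t0 \<in> J \<and> J \<subseteq> {t0..} \<and>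
     (\<forall>t\<in>J. x t \<in> D \<and> (x has_vector_derivative f (x t)) (at t within J))"

definition maximal_solution ::
  "(state \<Rightarrow> state) \<Rightarrow> state set \<Rightarrow> real \<Rightarrow> real set \<Rightarrow> (real \<Rightarrow> state) \<Rightarrow> bool" where
  "maximal_solution f D t0 J x \<longleftrightarrow>
     solution_on f D t0 J x \<and>
     (\<forall>J' y. solution_on f D t0 J' y \<and> J \<subseteq> J' \<and> (\<forall>t\<in>J. y t = x t) \<longrightarrow> J' = J)"

text \<open>Since the estimate is required for all \<open>t \<ge> t0\<close>, maximal solutions in \<open>D\<close> have to be global.\<close>

definition GES_on_D ::
  "(state \<Rightarrow> real) \<Rightarrow> (state \<Rightarrow> real) \<Rightarrow> (state \<Rightarrow> real) \<Rightarrow> bool" where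
  "GES_on_D v q rt \<longleftrightarrow>
     continuous_map (Metric_space.mtopology state_D dist_D) euclidean
       (\<lambda>(\<rho>, \<delta>, \<gamma>, \<zeta>, \<theta>).
          (v (\<rho>, \<delta>, \<gamma>, \<zeta>, \<theta>), q (\<rho>, \<delta>, \<gamma>, \<zeta>, \<theta>), rt (\<rho>, \<delta>, \<gamma>, \<zeta>, \<theta>) * cos \<theta>)) \<and>
     (\<exists>K\<ge>1. \<exists>c>0. \<forall>t0 J x.
        maximal_solution (\<lambda>\<Theta>. sys_rhs (v \<Theta>) (q \<Theta>) (rt \<Theta>) \<Theta>) state_D t0 J x \<longrightarrow>
        J = {t0..} \<and>
        (\<forall>t\<ge>t0. size_D (x t) \<le> K * size_D (x t0) * exp (- c * (t - t0))))"

definition class_K :: "(real \<Rightarrow> real) \<Rightarrow> bool" where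
  "class_K \<alpha> \<longleftrightarrow> continuous_on {0..} \<alpha> \<and> strict_mono_on {0..} \<alpha> \<and> \<alpha> 0 = 0"

text \<open>At \<open>\<rho> = 0\<close> the derivative \<open>V'\<close> is the one relative to \<open>\<Sigma>\<close>; it is unique because \<open>\<Sigma>\<close> is convex
  with nonempty interior.\<close>

definition strict_CLF :: "(state \<Rightarrow> real) \<Rightarrow> bool" where
  "strict_CLF V \<longleftrightarrow>
     (\<exists>\<alpha>1 \<alpha>2. class_K \<alpha>1 \<and> class_K \<alpha>2 \<and>
        (\<forall>\<Theta>\<in>state_Sigma. \<alpha>1 (size_D \<Theta>) \<le> V \<Theta> \<and> V \<Theta> \<le> \<alpha>2 (size_D \<Theta>))) \<and>
     (\<exists>V' :: state \<Rightarrow> state \<Rightarrow>\<^sub>L real.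
        (\<forall>\<Theta>\<in>state_Sigma. (V has_derivative blinfun_apply (V' \<Theta>)) (at \<Theta> within state_Sigma)) \<and>
        continuous_on state_Sigma V' \<and>
        (\<forall>\<Theta>\<in>state_Sigma - {0}. \<exists>u q rt. blinfun_apply (V' \<Theta>) (sys_rhs_ext u q rt \<Theta>) < 0))"

definition sigma1 :: "real \<Rightarrow> real \<Rightarrow> real" where
  "sigma1 a b = (if a = 0 then cos b else (sin (a - b) + sin b) / a)"

definition sigma2 :: "real \<Rightarrow> real \<Rightarrow> real" where
  "sigma2 a b = (if a = 0 then - sin b else (cos b - cos (a - b)) / a)"

lemma sigma1_has_derivative_sigma2: "(sigma1 a has_real_derivative sigma2 a b) (at b)"
proof (cases "a = 0")
  case True
  then have "sigma1 a = cos" "sigma2 a b = - sin b"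
    by (auto simp: sigma1_def sigma2_def fun_eq_iff)
  then show ?thesis by (auto intro!: derivative_eq_intros)
next
  case False
  then have "sigma1 a = (\<lambda>b. (sin (a - b) + sin b) / a)" "sigma2 a b = (cos b - cos (a - b)) / a"
    by (auto simp: sigma1_def sigma2_def fun_eq_iff)
  then show ?thesis by (auto intro!: derivative_eq_intros simp: False)
qed

definition auxN :: "real \<Rightarrow> real \<Rightarrow> real \<Rightarrow> real" where
  "auxN k2 \<delta> \<zeta> = sqrt (1 + k2\<^sup>2 * \<delta>\<^sup>2 * (cos \<zeta>)\<^sup>2)"

definition eta :: "real \<Rightarrow> real \<Rightarrow> real \<Rightarrow> real \<Rightarrow> real" where
  "eta k2 k3 \<delta> \<zeta> = (k3 * sin \<zeta> + tan \<zeta>) / sqrt (1 + k2\<^sup>2 * \<delta>\<^sup>2 * (cos \<zeta>)\<^sup>2)"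

definition auxB :: "real \<Rightarrow> real \<Rightarrow> real \<Rightarrow> real \<Rightarrow> real" where
  "auxB k2 k3 \<delta> \<zeta> = sqrt (1 + (eta k2 k3 \<delta> \<zeta>)\<^sup>2)"

definition auxC :: "real \<Rightarrow> real \<Rightarrow> real \<Rightarrow> real \<Rightarrow> real" where
  "auxC k2 k3 \<delta> \<zeta> =
     1 + k3 * cos \<zeta> + (tan \<zeta>)\<^sup>2 + k2\<^sup>2 * \<delta>\<^sup>2 * (2 + k3 * cos \<zeta> - (cos \<zeta>)\<^sup>2)"

definition err1 :: "real \<Rightarrow> real \<Rightarrow> real \<Rightarrow> real \<Rightarrow> real" where
  "err1 k2 \<delta> \<gamma> \<zeta> = \<gamma> + arctan (k2 * \<delta> * cos \<zeta>)"

definition err2 :: "real \<Rightarrow> real \<Rightarrow> real \<Rightarrow> real \<Rightarrow> real \<Rightarrow> real" where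
  "err2 k2 k3 \<delta> \<zeta> \<theta> = \<theta> + arctan (eta k2 k3 \<delta> \<zeta>)"

fun v_fb :: "real \<Rightarrow> real \<Rightarrow> real \<Rightarrow> state \<Rightarrow> real" where
  "v_fb k1 k2 k3 (\<rho>, \<delta>, \<gamma>, \<zeta>, \<theta>) = k1 * \<rho> * auxN k2 \<delta> \<zeta> * auxB k2 k3 \<delta> \<zeta>"

fun q_fb :: "real \<Rightarrow> real \<Rightarrow> real \<Rightarrow> real \<Rightarrow> state \<Rightarrow> real" where
  "q_fb k1 k2 k3 k5 (\<rho>, \<delta>, \<gamma>, \<zeta>, \<theta>) =
     (let N = auxN k2 \<delta> \<zeta>; B = auxB k2 k3 \<delta> \<zeta>; C = auxC k2 k3 \<delta> \<zeta>;
          e2 = err2 k2 k3 \<delta> \<zeta> \<theta>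
      in - k5 * e2 + k1 * k2 * \<delta>\<^sup>2 * sigma2 e2 \<theta> * B
         + k1 / (N\<^sup>2 * B) *
             (k2\<^sup>2 * \<delta> * cos \<theta> * cos \<zeta> * sin \<gamma> * (k3 * sin \<zeta> + tan \<zeta>)
              - (cos \<theta> * sin \<zeta> * cos \<gamma> + sin \<theta> * cos \<zeta>) * C)
         - k1 * \<rho>\<^sup>2 * B * (sin \<zeta> * sigma1 e2 \<theta> * N - cos \<zeta> * sigma2 e2 \<theta>)
         - k1 * tan \<zeta> * B / (cos \<zeta>)\<^sup>2 * (sin \<zeta> * sigma2 e2 \<theta> + cos \<zeta> * sigma1 e2 \<theta> * N))"

fun rt_fb :: "real \<Rightarrow> real \<Rightarrow> real \<Rightarrow> real \<Rightarrow> state \<Rightarrow> real" where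
  "rt_fb k1 k2 k3 k4 (\<rho>, \<delta>, \<gamma>, \<zeta>, \<theta>) =
     (let N = auxN k2 \<delta> \<zeta>; B = auxB k2 k3 \<delta> \<zeta>;
          e1 = err1 k2 \<delta> \<gamma> \<zeta>; e2 = err2 k2 k3 \<delta> \<zeta> \<theta>
      in k4 * e1 + k1 * N * B / cos \<zeta> * cos \<theta> * sin \<gamma>
         + k1 * k2 * B / N *
             (cos \<theta> * sin \<gamma>
              - \<delta> * (cos \<theta> * (sin \<zeta>)\<^sup>2 * cos \<gamma> + sin \<theta> * sin (2 * \<zeta>) / 2))
         - k1 * \<rho>\<^sup>2 * cos \<zeta> * N * (sigma2 e1 \<gamma> + e2 * sigma2 e1 \<gamma> * sigma2 e2 \<theta> * B)
         + k1 * \<delta> * sigma1 e1 \<gamma> * N / cos \<zeta> * (1 + e2 * sigma2 e2 \<theta> * B)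
         + k1 * tan \<zeta> * N / (cos \<zeta>)\<^sup>2 * sin \<zeta> *
             (sigma2 e1 \<gamma> + e2 * sigma2 e1 \<gamma> * sigma2 e2 \<theta> * B))"

fun lyap_V :: "real \<Rightarrow> real \<Rightarrow> state \<Rightarrow> real" where
  "lyap_V k2 k3 (\<rho>, \<delta>, \<gamma>, \<zeta>, \<theta>) =
     1 / 2 * (\<rho>\<^sup>2 + \<delta>\<^sup>2 + (tan \<zeta>)\<^sup>2 + (err1 k2 \<delta> \<gamma> \<zeta>)\<^sup>2 + (err2 k2 k3 \<delta> \<zeta> \<theta>)\<^sup>2)"

end

theory Submission
  imports Defs
begin

text \<open>
  With \<open>\<theta> = e2 - arctan \<eta>\<close> and \<open>\<gamma> = e1 - arctan (k2 \<delta> cos \<zeta>)\<close>, the functions \<open>\<sigma>1\<close>, \<open>\<sigma>2\<close> split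
  \<open>sin\<close> and \<open>cos\<close> of \<open>\<gamma>\<close> and \<open>\<theta>\<close> into their values at zero error plus multiples of \<open>e1\<close> and \<open>e2\<close>.
  The feedback cancels every term of \<open>V'\<close> carrying such a multiple and leaves
  \<open>V' = - k1 \<rho>\<^sup>2 (k3 sin\<^sup>2 \<zeta> + 1 / cos \<zeta>) - k1 k2 \<delta>\<^sup>2 - k1 k3 tan\<^sup>2 \<zeta> - k4 e1\<^sup>2 - k5 e2\<^sup>2 \<le> - 2 l V\<close>.
  Since \<open>V\<close> is comparable to the square of \<^const>\<open>size_D\<close>, this gives both the exponential estimate and
  the CLF property. Maximal solutions are global because the estimate bounds all coordinates, \<open>\<rho>\<close>
  decays at most exponentially and so stays away from \<open>0\<close> in finite time, and the closed-loop vector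
  field is locally Lipschitz, so that Picard iteration continues any solution confined to a
  compact subset of \<open>D\<close>.
\<close>

subsection \<open>Locally Lipschitz functions\<close>

definition sinc :: "real \<Rightarrow> real" where
  "sinc x = (if x = 0 then 1 else sin x / x)"

text \<open>Writing \<open>sinc\<close> as an average of cosines lets the Lipschitz bound of
  \<open>cos\<close> pass to \<open>sinc\<close> with no separate argument at the origin.\<close>

lemma sinc_has_integral: "((\<lambda>t. cos (t * x)) has_integral sinc x) {0..1}"
proof (cases "x = 0")
  case True
  then show ?thesis using has_integral_const_real[of "1::real" 0 1] by (simp add: sinc_def)
next
  case False
  have "((\<lambda>t. cos (t * x)) has_integral sin (1 * x) / x - sin (0 * x) / x) {0..1}"
    by (rule fundamental_theorem_of_calculus)
      (auto intro!: derivative_eq_intros simp: False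
        simp flip: has_real_derivative_iff_has_vector_derivative)
  then show ?thesis using False by (simp add: sinc_def)
qed

lemma abs_cos_diff_le: "\<bar>cos x - cos y\<bar> \<le> \<bar>x - y\<bar>" for x y :: real
proof -
  have "\<bar>cos x - cos y\<bar> = 2 * \<bar>sin ((x + y) / 2)\<bar> * \<bar>sin ((y - x) / 2)\<bar>"
    by (simp add: cos_diff_cos abs_mult)
  also have "\<dots> \<le> 2 * 1 * \<bar>(y - x) / 2\<bar>"
    by (intro mult_mono abs_sin_x_le_abs_x) auto
  finally show ?thesis by simp
qed

text \<open>For \<open>t\<close> in the unit interval the integrand \<open>cos (t * x)\<close> is
  1-Lipschitz in \<open>x\<close>, and averaging over \<open>t\<close> preserves the
  constant.\<close>

lemma sinc_lipschitz: "1-lipschitz_on UNIV sinc"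
proof (rule lipschitz_onI)
  fix x y :: real
  have "((\<lambda>t. cos (t * x) - cos (t * y)) has_integral sinc x - sinc y) (cbox 0 1)"
    using sinc_has_integral by (auto intro: has_integral_diff)
  moreover have "norm (cos (t * x) - cos (t * y)) \<le> \<bar>x - y\<bar>" if "t \<in> cbox 0 1" for t
  proof -
    have "\<bar>cos (t * x) - cos (t * y)\<bar> \<le> \<bar>t * x - t * y\<bar>" by (rule abs_cos_diff_le)
    also have "\<dots> = \<bar>t\<bar> * \<bar>x - y\<bar>" by (simp add: abs_mult flip: right_diff_distrib)
    also have "\<dots> \<le> \<bar>x - y\<bar>" using that by (intro mult_left_le_one_le) auto
    finally show ?thesis by simp
  qed
  ultimately have "norm (sinc x - sinc y) \<le> \<bar>x - y\<bar> * measure lborel (cbox 0 (1::real))"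
    by (intro has_integral_bound) auto
  then show "dist (sinc x) (sinc y) \<le> 1 * dist x y" by (simp add: dist_real_def)
qed simp

text \<open>Half-angle forms without the case distinction at \<open>a = 0\<close>, which makes regularity there visible.\<close>

lemma sigma1_eq_sinc: "sigma1 a b = sinc (a / 2) * cos (a / 2 - b)"
proof (cases "a = 0")
  case False
  have "sin (a - b) + sin b = 2 * sin (a / 2) * cos (a / 2 - b)"
    by (simp add: sin_plus_sin diff_divide_distrib)
  then show ?thesis using False by (simp add: sigma1_def sinc_def)
qed (simp add: sigma1_def sinc_def)

lemma sigma2_eq_sinc: "sigma2 a b = sinc (a / 2) * sin (a / 2 - b)"
proof (cases "a = 0")
  case False
  have "cos b - cos (a - b) = 2 * sin (a / 2) * sin (a / 2 - b)"
    by (simp add: cos_diff_cos diff_divide_distrib)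
  then show ?thesis using False by (simp add: sigma2_def sinc_def)
qed (simp add: sigma2_def sinc_def)

text \<open>Stated at a single point, so that side conditions of the closure rules, such as a
  nonzero denominator, concern only the value at that point. It yields both continuity and the
  hypothesis of Picard's theorem.\<close>

definition loc_lip :: "('a::metric_space \<Rightarrow> 'b::metric_space) \<Rightarrow> 'a \<Rightarrow> bool" where
  "loc_lip f x \<longleftrightarrow> (\<exists>e>0. \<exists>L. L-lipschitz_on (ball x e) f)"

lemma loc_lipI: "e > 0 \<Longrightarrow> L-lipschitz_on (ball x e) f \<Longrightarrow> loc_lip f x"
  by (auto simp: loc_lip_def)

lemma lipschitz_on_imp_loc_lip: "L-lipschitz_on UNIV f \<Longrightarrow> loc_lip f x"
  by (rule loc_lipI[of 1]) (auto intro: lipschitz_on_subset)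

lemma loc_lip_pairE:
  assumes "loc_lip f x" "loc_lip g x"
  obtains e L M where "e > 0" "L-lipschitz_on (ball x e) f" "M-lipschitz_on (ball x e) g"
proof -
  obtain d e L M where "d > 0" "L-lipschitz_on (ball x d) f"
      "e > 0" "M-lipschitz_on (ball x e) g"
    using assms by (auto simp: loc_lip_def)
  then show thesis
    by (intro that[of "min d e" L M]) (auto elim!: lipschitz_on_subset)
qed

lemma loc_lip_imp_isCont:
  assumes "loc_lip f x"
  shows "isCont f x"
proof -
  obtain e L where "e > 0" "L-lipschitz_on (ball x e) f"
    using assms by (auto simp: loc_lip_def)
  then show ?thesis
    using continuous_on_eq_continuous_at[OF open_ball] centre_in_ball
    by (metis lipschitz_on_continuous_on)
qed

text \<open>Continuity of \<open>f\<close> shrinks the ball around \<open>x\<close> until its image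
  lies in the ball on which \<open>g\<close> is Lipschitz; there the constants multiply.\<close>

lemma loc_lip_compose:
  assumes "loc_lip g (f x)" "loc_lip f x"
  shows "loc_lip (\<lambda>x. g (f x)) x"
proof -
  obtain d e L M where d: "d > 0" "M-lipschitz_on (ball (f x) d) g"
      and e: "e > 0" "L-lipschitz_on (ball x e) f"
    using assms by (auto simp: loc_lip_def)
  obtain e' where e': "e' > 0" "\<And>y. dist y x < e' \<Longrightarrow> dist (f y) (f x) < d"
    using loc_lip_imp_isCont[OF assms(2)] d(1) by (metis continuous_at_eps_delta)
  have "f ` ball x (min e e') \<subseteq> ball (f x) d"
    using e'(2) by (auto simp: dist_commute)
  then have "(M * L)-lipschitz_on (ball x (min e e')) (\<lambda>x. g (f x))"
    by (intro lipschitz_on_compose2[of L _ f M g] lipschitz_on_subset[OF d(2)]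
        lipschitz_on_subset[OF e(2)]) auto
  then show ?thesis using e(1) e'(1) by (intro loc_lipI[of "min e e'"]) auto
qed

section \<open>Closure rules for local Lipschitz continuity\<close>

lemma loc_lip_const: "loc_lip (\<lambda>x. c) x"
  by (rule lipschitz_on_imp_loc_lip[OF lipschitz_on_constant])

lemma loc_lip_id: "loc_lip (\<lambda>x. x) x"
  by (rule lipschitz_on_imp_loc_lip[OF lipschitz_on_id])

lemma loc_lip_fst: "loc_lip f x \<Longrightarrow> loc_lip (\<lambda>x. fst (f x)) x"
  by (rule loc_lip_compose[of fst], rule lipschitz_on_imp_loc_lip[of 1])
    (simp_all add: lipschitz_on_def dist_fst_le del: split_paired_All)

lemma loc_lip_snd: "loc_lip f x \<Longrightarrow> loc_lip (\<lambda>x. snd (f x)) x"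
  by (rule loc_lip_compose[of snd], rule lipschitz_on_imp_loc_lip[of 1])
    (simp_all add: lipschitz_on_def dist_snd_le del: split_paired_All)

lemma loc_lip_Pair:
  assumes "loc_lip f x" "loc_lip g x"
  shows "loc_lip (\<lambda>x. (f x, g x)) x"
  by (rule loc_lip_pairE[OF assms], rule loc_lipI, assumption, rule lipschitz_on_Pair)

lemma loc_lip_add:
  fixes f g :: "_ \<Rightarrow> 'b::real_normed_vector"
  assumes "loc_lip f x" "loc_lip g x"
  shows "loc_lip (\<lambda>x. f x + g x) x"
  by (rule loc_lip_pairE[OF assms], rule loc_lipI, assumption, rule lipschitz_on_add)

lemma loc_lip_diff:
  fixes f g :: "_ \<Rightarrow> 'b::real_normed_vector"
  assumes "loc_lip f x" "loc_lip g x"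
  shows "loc_lip (\<lambda>x. f x - g x) x"
  by (rule loc_lip_pairE[OF assms], rule loc_lipI, assumption, rule lipschitz_on_diff)

lemma loc_lip_mult:
  fixes f g :: "_ \<Rightarrow> real"
  assumes "loc_lip f x" "loc_lip g x"
  shows "loc_lip (\<lambda>x. f x * g x) x"
proof -
  obtain e L M where e: "e > 0" and f: "L-lipschitz_on (ball x e) f"
      and g: "M-lipschitz_on (ball x e) g"
    using assms by (rule loc_lip_pairE)
  note pos = lipschitz_on_nonneg[OF f] lipschitz_on_nonneg[OF g]
  let ?F = "\<bar>f x\<bar> + L * e" and ?G = "\<bar>g x\<bar> + M * e"
  \<comment> \<open>A Lipschitz function on a ball is bounded there, which is what makes the product
    of two such functions Lipschitz.\<close>
  have bd: "\<bar>h y\<bar> \<le> \<bar>h x\<bar> + C * e" if "C-lipschitz_on (ball x e) h" "y \<in> ball x e" for h y C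
  proof -
    have "dist (h y) (h x) \<le> C * dist y x" using that e by (auto intro: lipschitz_onD)
    also have "\<dots> \<le> C * e"
      using that lipschitz_on_nonneg by (auto intro!: mult_left_mono simp: dist_commute)
    finally show ?thesis by (simp add: dist_real_def)
  qed
  have "(?F * M + ?G * L)-lipschitz_on (ball x e) (\<lambda>x. f x * g x)"
  proof (rule lipschitz_onI)
    fix y z assume yz: "y \<in> ball x e" "z \<in> ball x e"
    have "dist (f y * g y) (f z * g z) = \<bar>f y * (g y - g z) + g z * (f y - f z)\<bar>"
      by (simp add: dist_real_def algebra_simps)
    also have "\<dots> \<le> \<bar>f y\<bar> * \<bar>g y - g z\<bar> + \<bar>g z\<bar> * \<bar>f y - f z\<bar>"
      by (metis abs_mult abs_triangle_ineq)
    also have "\<dots> \<le> ?F * (M * dist y z) + ?G * (L * dist y z)"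
      using lipschitz_onD[OF f yz] lipschitz_onD[OF g yz] bd[OF f yz(1)] bd[OF g yz(2)] pos e
      by (intro add_mono mult_mono) (auto simp: dist_real_def)
    finally show "dist (f y * g y) (f z * g z) \<le> (?F * M + ?G * L) * dist y z"
      by (simp add: algebra_simps)
  qed (use pos e in auto)
  with e show ?thesis by (rule loc_lipI)
qed

lemma loc_lip_power:
  fixes f :: "_ \<Rightarrow> real"
  shows "loc_lip f x \<Longrightarrow> loc_lip (\<lambda>x. f x ^ n) x"
  by (induction n) (auto intro: loc_lip_const loc_lip_mult)

text \<open>A continuous derivative is bounded on a compact ball inside \<open>S\<close>, and the
  mean value inequality turns the bound into a Lipschitz constant. This covers all the elementary
  functions below.\<close>

lemma loc_lip_real_derivative:
  fixes g :: "real \<Rightarrow> real"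
  assumes "open S" "y \<in> S" "\<And>z. z \<in> S \<Longrightarrow> (g has_real_derivative g' z) (at z)"
    "continuous_on S g'"
  shows "loc_lip g y"
proof -
  obtain e where e: "e > 0" "cball y e \<subseteq> S"
    using assms open_contains_cball by blast
  have "compact (g' ` cball y e)"
    using continuous_on_subset[OF assms(4) e(2)] by (rule compact_continuous_image) simp
  then obtain C where C: "C > 0" "\<And>z. z \<in> cball y e \<Longrightarrow> \<bar>g' z\<bar> \<le> C"
    by (metis bounded_pos compact_imp_bounded imageI real_norm_def)
  have "C-lipschitz_on (ball y e) g"
  proof (rule lipschitz_onI)
    fix a b assume "a \<in> ball y e" "b \<in> ball y e"
    then show "dist (g a) (g b) \<le> C * dist a b"
      unfolding dist_norm
    proof (intro field_differentiable_bound[of "ball y e" g g'])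
      fix z assume "z \<in> ball y e"
      then have "z \<in> cball y e" using ball_subset_cball by blast
      then show "(g has_real_derivative g' z) (at z within ball y e)" "norm (g' z) \<le> C"
        using e(2) C(2) by (auto intro: has_field_derivative_at_within[OF assms(3)])
    qed auto
  qed (use C in simp)
  with e(1) show ?thesis by (rule loc_lipI)
qed

lemma loc_lip_sinc: "loc_lip f x \<Longrightarrow> loc_lip (\<lambda>x. sinc (f x)) x"
  using loc_lip_compose[OF lipschitz_on_imp_loc_lip[OF sinc_lipschitz]] .

lemma loc_lip_sin: "loc_lip f x \<Longrightarrow> loc_lip (\<lambda>x. sin (f x :: real)) x"
  by (rule loc_lip_compose[OF loc_lip_real_derivative[OF open_UNIV UNIV_I DERIV_sin]])
    (simp_all add: continuous_on_cos)

lemma loc_lip_cos: "loc_lip f x \<Longrightarrow> loc_lip (\<lambda>x. cos (f x :: real)) x"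
  by (rule loc_lip_compose[OF loc_lip_real_derivative[OF open_UNIV UNIV_I DERIV_cos]])
    (simp_all add: continuous_on_sin continuous_on_minus)

lemma loc_lip_arctan: "loc_lip f x \<Longrightarrow> loc_lip (\<lambda>x. arctan (f x)) x"
  by (rule loc_lip_compose[OF loc_lip_real_derivative[OF open_UNIV UNIV_I DERIV_arctan]])
    (simp_all, intro continuous_intros, simp add: add_nonneg_eq_0_iff)

lemma loc_lip_inverse:
  fixes f :: "_ \<Rightarrow> real"
  assumes "loc_lip f x" "f x \<noteq> 0"
  shows "loc_lip (\<lambda>x. inverse (f x)) x"
proof (rule loc_lip_compose[OF _ assms(1)])
  show "loc_lip inverse (f x)"
  proof (rule loc_lip_real_derivative)
    show "(inverse has_real_derivative - (inverse z ^ Suc (Suc 0))) (at z)" if "z \<in> - {0}" for z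
      using that by (intro DERIV_inverse) simp
    show "continuous_on (- {0}) (\<lambda>z. - (inverse z ^ Suc (Suc 0)) :: real)"
      by (intro continuous_intros) simp
  qed (use assms in auto)
qed

lemma loc_lip_divide:
  fixes f g :: "_ \<Rightarrow> real"
  assumes "loc_lip f x" "loc_lip g x" "g x \<noteq> 0"
  shows "loc_lip (\<lambda>x. f x / g x) x"
  unfolding divide_inverse by (intro loc_lip_mult loc_lip_inverse assms)

lemma loc_lip_tan: "loc_lip f x \<Longrightarrow> cos (f x) \<noteq> 0 \<Longrightarrow> loc_lip (\<lambda>x. tan (f x :: real)) x"
  unfolding tan_def by (intro loc_lip_divide loc_lip_sin loc_lip_cos)

lemma loc_lip_sqrt:
  assumes "loc_lip f x" "f x > 0"
  shows "loc_lip (\<lambda>x. sqrt (f x)) x"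
proof (rule loc_lip_compose[OF _ assms(1)])
  show "loc_lip sqrt (f x)"
  proof (rule loc_lip_real_derivative)
    show "(sqrt has_real_derivative inverse (sqrt z) / 2) (at z)" if "z \<in> {0<..}" for z
      using that by (intro DERIV_real_sqrt) simp
    show "continuous_on {0<..} (\<lambda>z. inverse (sqrt z) / 2)"
      by (intro continuous_intros) auto
  qed (use assms in auto)
qed

lemmas loc_lip_intros = loc_lip_const loc_lip_id loc_lip_fst loc_lip_snd loc_lip_Pair
  loc_lip_add loc_lip_diff loc_lip_mult loc_lip_power loc_lip_sinc loc_lip_sin
  loc_lip_cos loc_lip_arctan loc_lip_divide loc_lip_tan loc_lip_sqrt

subsection \<open>Continuation of maximal solutions\<close>

text \<open>A solution is a fixed point of the integral operator \<open>F\<close>, which contracts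
  with factor \<open>L * h\<close> in the supremum metric. Banach's theorem is applied in the
  complete space of bounded continuous functions on the whole line.\<close>

lemma picard_lipschitz:
  fixes f :: "'a::banach \<Rightarrow> 'a"
  assumes L: "L-lipschitz_on UNIV f" and M: "\<And>x. norm (f x) \<le> M"
    and h: "h > 0" "L * h < 1"
  obtains z where "z t0 = y"
    "\<And>t. t \<in> {t0..t0 + h} \<Longrightarrow> (z has_vector_derivative f (z t)) (at t within {t0..t0 + h})"
proof -
  define F where "F z t = y + integral {t0..t} (\<lambda>s. f (z s))" for z t
  let ?I = "{t0..t0 + h}"
  have contf: "continuous_on S f" for S
    using lipschitz_on_continuous_on[OF L] by (rule continuous_on_subset) simp
  have fc: "continuous_on S (\<lambda>s. f (apply_bcontfun z s))" for z S
    by (rule continuous_on_compose2[OF contf]) auto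
  have der: "(F (apply_bcontfun z) has_vector_derivative f (apply_bcontfun z t)) (at t within ?I)"
    if "t \<in> ?I" for z t
    unfolding F_def using integral_has_vector_derivative[OF fc that]
    by (auto intro!: derivative_eq_intros)
  have contF: "continuous_on ?I (F (apply_bcontfun z))" for z
    using der by (rule continuous_on_vector_derivative)
  \<comment> \<open>Clamping the time to the interval freezes the function at its end values
    outside, so that the Picard iterate becomes bounded and continuous on the whole line.\<close>
  have "\<exists>w. \<forall>t. apply_bcontfun w t = F (apply_bcontfun z) (clamp t0 (t0 + h) t)" for z
    using continuous_on_cbox_bcontfunE[of t0 "t0 + h" "F (apply_bcontfun z)"] contF
    by (metis cbox_interval)
  then obtain P where P: "\<And>z t. apply_bcontfun (P z) t = F (apply_bcontfun z) (clamp t0 (t0 + h) t)"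
    by metis
  have contr: "dist (P z) (P w) \<le> (L * h) * dist z w" for z w
  proof (rule dist_bound)
    fix t
    define c where "c = clamp t0 (t0 + h) t"
    have "c \<in> cbox t0 (t0 + h)" unfolding c_def using h by (intro clamp_in_interval) auto
    then have c: "t0 \<le> c" "c \<le> t0 + h" by auto
    have "dist (P z t) (P w t) = norm (integral {t0..c} (\<lambda>s. f (z s) - f (w s)))"
      by (simp add: P F_def dist_norm integral_diff integrable_continuous_real fc flip: c_def)
    also have "\<dots> \<le> L * dist z w * (c - t0)"
    proof (rule integral_bound)
      fix s
      have "dist (f (z s)) (f (w s)) \<le> L * dist (z s) (w s)" using lipschitz_onD[OF L] by simp
      also have "\<dots> \<le> L * dist z w"
        by (intro mult_left_mono dist_bounded lipschitz_on_nonneg[OF L])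
      finally show "norm (f (z s) - f (w s)) \<le> L * dist z w" by (simp add: dist_norm)
    qed (use c in \<open>auto intro!: continuous_on_diff fc\<close>)
    also have "\<dots> \<le> L * dist z w * h"
      using c lipschitz_on_nonneg[OF L] by (intro mult_left_mono) auto
    finally show "dist (P z t) (P w t) \<le> (L * h) * dist z w" by (simp add: mult_ac)
  qed
  have "\<exists>!z. P z = z"
    by (rule banach_fix_type[of "L * h"]) (use contr h lipschitz_on_nonneg[OF L] in auto)
  then obtain z where "P z = z" by blast
  then have z: "apply_bcontfun z t = F (apply_bcontfun z) t" if "t \<in> ?I" for t
    using P[of z t] that by simp
  show thesis
  proof (rule that)
    show "apply_bcontfun z t0 = y" using z[of t0] h by (simp add: F_def)
    show "(apply_bcontfun z has_vector_derivative f (apply_bcontfun z t)) (at t within ?I)"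
      if "t \<in> ?I" for t
      by (rule has_vector_derivative_transform[OF that z der[OF that]])
  qed
qed

text \<open>The vector field is truncated to a small closed ball, the global version is applied, and
  a speed bound shows that for a short time the solution stays in the ball, where the truncation
  changes nothing.\<close>

lemma picard_local:
  fixes f :: "'a::euclidean_space \<Rightarrow> 'a"
  assumes "open D" "y \<in> D" "loc_lip f y"
  obtains h z where "h > 0" "z t0 = y" "\<And>t. t \<in> {t0..t0 + h} \<Longrightarrow> z t \<in> D"
    "\<And>t. t \<in> {t0..t0 + h} \<Longrightarrow> (z has_vector_derivative f (z t)) (at t within {t0..t0 + h})"
proof -
  obtain e L where e: "e > 0" "L-lipschitz_on (ball y e) f"
    using assms(3) by (auto simp: loc_lip_def)
  obtain d where d: "d > 0" "ball y d \<subseteq> D"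
    using assms openE by blast
  \<comment> \<open>Halving puts the closed ball inside both open balls.\<close>
  define r where "r = min d e / 2"
  have r: "r > 0" "cball y r \<subseteq> ball y e" "cball y r \<subseteq> D"
    using e(1) d by (auto simp: r_def)
  \<comment> \<open>composing with the projection \<open>?p\<close> makes \<open>f\<close> globally Lipschitz and bounded\<close>
  let ?p = "closest_point (cball y r)"
  have pin: "?p x \<in> cball y r" for x
    using r by (intro closest_point_in_set) auto
  have L: "L-lipschitz_on (cball y r) f" using lipschitz_on_subset[OF e(2) r(2)] .
  have L0: "L \<ge> 0" using lipschitz_on_nonneg[OF L] .
  have lip: "L-lipschitz_on UNIV (\<lambda>x. f (?p x))"
  proof (rule lipschitz_onI)
    fix x w
    have "dist (f (?p x)) (f (?p w)) \<le> L * dist (?p x) (?p w)"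
      using lipschitz_onD[OF L pin pin] .
    also have "\<dots> \<le> L * dist x w"
      using r L0 by (intro mult_left_mono closest_point_lipschitz) auto
    finally show "dist (f (?p x)) (f (?p w)) \<le> L * dist x w" .
  qed fact
  define M where "M = norm (f y) + L * r"
  have M: "norm (f (?p x)) \<le> M" for x
  proof -
    have "norm (f (?p x)) \<le> norm (f y) + dist (f (?p x)) (f y)"
      by (metis dist_norm norm_triangle_sub)
    also have "dist (f (?p x)) (f y) \<le> L * dist (?p x) y"
      using r by (intro lipschitz_onD[OF L pin]) auto
    also have "\<dots> \<le> L * r" using pin[of x] L0 by (intro mult_left_mono) (auto simp: dist_commute)
    finally show ?thesis by (simp add: M_def)
  qed
  have M0: "M \<ge> 0" using r L0 by (simp add: M_def)
  \<comment> \<open>The first entry gives the contraction condition \<open>L * h < 1\<close>, the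
    second keeps the travelled distance \<open>M * h\<close> within \<open>r\<close>; the added ones
    keep the denominators positive when \<open>L\<close> or \<open>M\<close> vanishes.\<close>
  define h where "h = min (1 / (2 * (L + 1))) (r / (M + 1))"
  have h0: "h > 0" using L0 M0 r by (simp add: h_def)
  have "L * h \<le> L * (1 / (2 * (L + 1)))" unfolding h_def using L0 by (intro mult_left_mono) auto
  also have "\<dots> < 1" using L0 by (simp add: field_simps)
  finally have hL: "L * h < 1" .
  have "M * h \<le> M * (r / (M + 1))" unfolding h_def using M0 by (intro mult_left_mono) auto
  also have "\<dots> \<le> r" using M0 r by (simp add: field_simps)
  finally have hM: "M * h \<le> r" .
  obtain z where z: "z t0 = y"
    "\<And>t. t \<in> {t0..t0 + h} \<Longrightarrow> (z has_vector_derivative f (?p (z t))) (at t within {t0..t0 + h})"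
    using picard_lipschitz[OF lip M h0 hL] by blast
  have inball: "z t \<in> cball y r" if "t \<in> {t0..t0 + h}" for t
  proof -
    have "norm (z t - z t0) \<le> M * norm (t - t0)"
    proof (rule differentiable_bound)
      show "(z has_derivative (\<lambda>s. s *\<^sub>R f (?p (z u)))) (at u within {t0..t0 + h})"
        if "u \<in> {t0..t0 + h}" for u
        using z(2)[OF that] by (simp add: has_vector_derivative_def)
      show "onorm (\<lambda>s. s *\<^sub>R f (?p (z u))) \<le> M" for u
        by (rule onorm_le) (auto simp: mult.commute[of M] intro!: mult_left_mono M)
    qed (use that h0 in auto)
    also have "\<dots> \<le> M * h" using that M0 by (intro mult_left_mono) auto
    finally show ?thesis using hM z(1) by (simp add: dist_norm norm_minus_commute)
  qed
  show thesis
  proof (rule that)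
    show "(z has_vector_derivative f (z t)) (at t within {t0..t0 + h})" if "t \<in> {t0..t0 + h}" for t
      using z(2)[OF that] inball[OF that] by (simp add: closest_point_self)
  qed (use h0 z inball r in auto)
qed

text \<open>On the compact set \<open>K\<close> the speed is bounded, so \<open>x\<close> is
  Lipschitz and has a limit at \<open>T\<close>. This limit lies in \<open>K\<close>, and the
  differential equation is recovered at \<open>T\<close> from its integral form.\<close>

lemma solution_extends_to_endpoint:
  fixes f :: "state \<Rightarrow> state"
  assumes sol: "solution_on f D t0 {t0..<T} x" and "t0 < T"
    and K: "compact K" "K \<subseteq> D" "\<And>t. t \<in> {t0..<T} \<Longrightarrow> x t \<in> K"
    and contf: "continuous_on D f"
  obtains z where "solution_on f D t0 {t0..T} z" "\<And>t. t \<in> {t0..<T} \<Longrightarrow> z t = x t"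
proof -
  have der: "(x has_vector_derivative f (x t)) (at t within {t0..<T})" if "t \<in> {t0..<T}" for t
    using sol that by (auto simp: solution_on_def)
  have "compact (f ` K)"
    using continuous_on_subset[OF contf K(2)] K(1) by (rule compact_continuous_image)
  then obtain M where M: "M > 0" "\<And>y. y \<in> K \<Longrightarrow> norm (f y) \<le> M"
    by (metis bounded_pos compact_imp_bounded imageI)
  have "M-lipschitz_on {t0..<T} x"
  proof (rule bounded_derivative_imp_lipschitz)
    show "(x has_derivative (\<lambda>s. s *\<^sub>R f (x t))) (at t within {t0..<T})" if "t \<in> {t0..<T}" for t
      using der[OF that] by (simp add: has_vector_derivative_def)
    show "onorm (\<lambda>s. s *\<^sub>R f (x t)) \<le> M" if "t \<in> {t0..<T}" for t
      by (rule onorm_le) (auto simp: mult.commute[of M] intro!: mult_left_mono M K that)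
  qed (use M in auto)
  then have "uniformly_continuous_on {t0..<T} x" by (rule lipschitz_on_uniformly_continuous)
  then obtain z where z: "uniformly_continuous_on (closure {t0..<T}) z"
      "\<And>t. t \<in> {t0..<T} \<Longrightarrow> x t = z t"
    using uniformly_continuous_on_extension_on_closure by metis
  have cl: "closure {t0..<T} = {t0..T}" using \<open>t0 < T\<close> by simp
  have zc: "continuous_on {t0..T} z"
    using z(1) unfolding cl by (rule uniformly_continuous_imp_continuous)
  \<comment> \<open>Compactness, hence closedness, of \<open>K\<close> keeps the new endpoint value
    inside \<open>D\<close>.\<close>
  have "z ` closure {t0..<T} \<subseteq> K"
    by (rule image_closure_subset) (use zc cl K z(2) compact_imp_closed in auto)
  then have zK: "z t \<in> K" if "t \<in> {t0..T}" for t using that cl by auto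
  have fz: "continuous_on {t0..T} (\<lambda>t. f (z t))"
    by (rule continuous_on_compose2[OF contf zc]) (use zK K(2) in auto)
  \<comment> \<open>The fundamental theorem needs the derivative only in the interior, so this holds
    up to \<open>t = T\<close> before anything is known about the derivative there.\<close>
  have int: "z t = z t0 + integral {t0..t} (\<lambda>s. f (z s))" if "t \<in> {t0..T}" for t
  proof -
    have "((\<lambda>s. f (z s)) has_integral z t - z t0) {t0..t}"
    proof (rule fundamental_theorem_of_calculus_interior)
      show "continuous_on {t0..t} z" by (rule continuous_on_subset[OF zc]) (use that in auto)
      fix s assume s: "s \<in> {t0<..<t}"
      then have s': "s \<in> {t0<..<T}" "s \<in> {t0..<T}" using that by auto
      have "(x has_vector_derivative f (x s)) (at s within {t0<..<T})"
        by (rule has_vector_derivative_within_subset[OF der]) (use s' in auto)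
      then have "(z has_vector_derivative f (x s)) (at s within {t0<..<T})"
        by (rule has_vector_derivative_transform[rotated 2]) (use s' z(2) in auto)
      then show "(z has_vector_derivative f (z s)) (at s)"
        using s' z(2)[of s] at_within_open[of s "{t0<..<T}"] by simp
    qed (use that in auto)
    then show ?thesis by (simp add: integral_unique)
  qed
  \<comment> \<open>Differentiating the integral equation gives the derivative at every point,
    including the one-sided one at \<open>T\<close>.\<close>
  have "(z has_vector_derivative f (z t)) (at t within {t0..T})" if "t \<in> {t0..T}" for t
  proof -
    have "((\<lambda>t. z t0 + integral {t0..t} (\<lambda>s. f (z s))) has_vector_derivative f (z t))
        (at t within {t0..T})"
      using integral_has_vector_derivative[OF fz that] by (auto intro!: derivative_eq_intros)
    then show ?thesis by (rule has_vector_derivative_transform[rotated 2, OF _ that int])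
  qed
  then have "solution_on f D t0 {t0..T} z"
    using zK K(2) \<open>t0 < T\<close> by (auto simp: solution_on_def is_interval_cc)
  then show thesis using z(2) by (intro that) auto
qed

text \<open>The one-sided derivatives agree at the junction because both equal the vector field at
  the common value \<open>x T = z T\<close>.\<close>

lemma solution_concat:
  fixes f :: "state \<Rightarrow> state"
  assumes sol: "solution_on f D t0 {t0..T} x" and "h > 0" and "z T = x T"
    and "\<And>t. t \<in> {T..T + h} \<Longrightarrow> z t \<in> D"
    and z: "\<And>t. t \<in> {T..T + h} \<Longrightarrow> (z has_vector_derivative f (z t)) (at t within {T..T + h})"
  shows "solution_on f D t0 {t0..T + h} (\<lambda>t. if t \<in> {t0..T} then x t else z t)"
proof -
  have T: "t0 \<le> T" using sol by (auto simp: solution_on_def)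
  have x: "(x has_vector_derivative f (x t)) (at t within {t0..T})" if "t \<in> {t0..T}" for t
    using sol that by (auto simp: solution_on_def)
  \<comment> \<open>The gluing rule asks for derivatives within each piece enlarged by the common
    boundary; these closed intervals meet only in \<open>T\<close> and already contain it.\<close>
  have Un: "{t0..T} \<union> {T} = {t0..T}" "{T..T + h} \<union> {T} = {T..T + h}"
    "closure {t0..T} \<inter> closure {T..T + h} = {T}"
    using T \<open>h > 0\<close> by auto
  have "((\<lambda>t. if t \<in> {t0..T} then x t else z t) has_vector_derivative
      (if t \<in> {t0..T} then f (x t) else f (z t))) (at t within {t0..T + h})"
    if t: "t \<in> {t0..T + h}" for t
  proof (rule has_vector_derivative_If_within_closures[where T = "{T..T + h}"])
    show "t \<in> {t0..T} \<union> {T..T + h}" "{t0..T + h} = {t0..T} \<union> {T..T + h}"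
      using T t \<open>h > 0\<close> by auto
    have "t = T" if "t \<in> closure {t0..T}" "t \<in> closure {T..T + h}" using that by auto
    then show "x t = z t" "f (x t) = f (z t)" if "t \<in> closure {t0..T}" "t \<in> closure {T..T + h}"
      using that \<open>z T = x T\<close> by auto
  qed (use x z in \<open>simp_all only: Un\<close>)
  then show ?thesis
    using assms T unfolding solution_on_def by (auto simp: is_interval_cc if_distrib)
qed

text \<open>A domain other than the half-line has a finite supremum \<open>T\<close>. If
  \<open>T\<close> is missing, the solution extends to it; if \<open>T\<close> is attained, Picard
  continues beyond it. Either way maximality fails.\<close>

lemma maximal_solution_global:
  fixes f :: "state \<Rightarrow> state"
  assumes "open D" and lip: "\<And>y. y \<in> D \<Longrightarrow> loc_lip f y"
    and max: "maximal_solution f D t0 J x"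
    and conf: "\<And>T. T \<ge> t0 \<Longrightarrow> \<exists>K. compact K \<and> K \<subseteq> D \<and> (\<forall>t\<in>J. t \<le> T \<longrightarrow> x t \<in> K)"
  shows "J = {t0..}"
proof (rule ccontr)
  assume "J \<noteq> {t0..}"
  have sol: "solution_on f D t0 J x" using max by (simp add: maximal_solution_def)
  have ext: "J' = J" if "solution_on f D t0 J' y" "J \<subseteq> J'" "\<forall>t\<in>J. y t = x t" for J' y
    using max that unfolding maximal_solution_def by blast
  have J: "is_interval J" "t0 \<in> J" "J \<subseteq> {t0..}" using sol by (auto simp: solution_on_def)
  obtain b where b: "b \<ge> t0" "b \<notin> J" using \<open>J \<noteq> {t0..}\<close> J(3) by auto
  \<comment> \<open>An interval that contains \<open>t0\<close> and omits a later point
    \<open>b\<close> lies entirely below \<open>b\<close>.\<close>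
  have Jb: "t < b" if "t \<in> J" for t
    using J(1,2) b that unfolding is_interval_1 by (meson linorder_not_le)
  define T where "T = Sup J"
  have bdd: "bdd_above J" using Jb by (meson bdd_above.I less_imp_le)
  have le_T: "t \<le> T" if "t \<in> J" for t unfolding T_def using bdd that by (intro cSup_upper)
  have below: "t \<in> J" if "t0 \<le> t" "t < T" for t
  proof -
    have "\<exists>s\<in>J. t < s" using that(2) J(2) bdd unfolding T_def by (subst (asm) less_cSup_iff) auto
    then obtain s where "s \<in> J" "t < s" by blast
    then show ?thesis using J(1,2) that(1) unfolding is_interval_1 by (meson less_imp_le)
  qed
  have contf: "continuous_on D f"
    using lip loc_lip_imp_isCont continuous_at_imp_continuous_on by blast
  obtain K where K: "compact K" "K \<subseteq> D" "\<And>t. t \<in> J \<Longrightarrow> x t \<in> K"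
    using conf[OF le_T[OF J(2)]] le_T by blast
  show False
  proof (cases "T \<in> J")
    case False
    then have "t < T" if "t \<in> J" for t using le_T[OF that] that by (cases "t = T") auto
    then have JT: "J = {t0..<T}" using J(3) below by force
    then have "t0 < T" using J(2) by auto
    then obtain z where "solution_on f D t0 {t0..T} z" "\<And>t. t \<in> {t0..<T} \<Longrightarrow> z t = x t"
      using solution_extends_to_endpoint[OF sol[unfolded JT] _ K(1,2)] K(3) JT contf by blast
    then have "{t0..T} = J" using JT by (intro ext) auto
    then show False using False \<open>t0 < T\<close> by auto
  next
    case True
    have JT: "J = {t0..T}" using J(3) le_T below True by force
    obtain h z where hz: "h > 0" "z T = x T" "\<And>t. t \<in> {T..T + h} \<Longrightarrow> z t \<in> D"
        "\<And>t. t \<in> {T..T + h} \<Longrightarrow> (z has_vector_derivative f (z t)) (at t within {T..T + h})"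
      using picard_local[OF \<open>open D\<close> _ lip, of "x T" T] K True by blast
    have "{t0..T + h} = J"
      using solution_concat[OF sol[unfolded JT] hz] hz(1) JT by (intro ext) auto
    moreover have "T + h \<in> {t0..T + h}" using hz(1) le_T[OF J(2)] by auto
    ultimately show False using le_T hz(1) by fastforce
  qed
qed

subsection \<open>The Lyapunov function along the closed loop\<close>

lemma cos_pos_strip: "\<bar>\<zeta>\<bar> < pi / 2 \<Longrightarrow> cos \<zeta> > 0"
  by (rule cos_gt_zero_pi) (simp_all only: abs_less_iff, linarith+)

lemma auxN_pos: "auxN k2 \<delta> \<zeta> > 0"
  unfolding auxN_def by (intro real_sqrt_gt_zero add_pos_nonneg) auto

lemma auxN_ge_1: "auxN k2 \<delta> \<zeta> \<ge> 1"
  unfolding auxN_def by simp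

lemma auxN_sq: "(auxN k2 \<delta> \<zeta>)\<^sup>2 = 1 + k2\<^sup>2 * \<delta>\<^sup>2 * (cos \<zeta>)\<^sup>2"
  unfolding auxN_def by (intro real_sqrt_pow2 add_nonneg_nonneg) auto

lemma auxB_pos: "auxB k2 k3 \<delta> \<zeta> > 0"
  unfolding auxB_def by (intro real_sqrt_gt_zero add_pos_nonneg) auto

lemma auxB_sq: "(auxB k2 k3 \<delta> \<zeta>)\<^sup>2 = 1 + (eta k2 k3 \<delta> \<zeta>)\<^sup>2"
  unfolding auxB_def by (intro real_sqrt_pow2 add_nonneg_nonneg) auto

lemma eta_eq: "eta k2 k3 \<delta> \<zeta> = (k3 * sin \<zeta> + tan \<zeta>) / auxN k2 \<delta> \<zeta>"
  by (simp add: eta_def auxN_def)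

section \<open>Derivatives of the errors and the gradient of \<open>lyap_V\<close>\<close>

lemma auxN_has_derivative:
  assumes "(D has_derivative D') (at x)" "(Z has_derivative Z') (at x)"
  shows "((\<lambda>x. auxN k2 (D x) (Z x)) has_derivative
    (\<lambda>h. k2\<^sup>2 * D x * cos (Z x) * (cos (Z x) * D' h - D x * sin (Z x) * Z' h) / auxN k2 (D x) (Z x)))
    (at x)"
proof -
  have "1 + k2\<^sup>2 * (D x)\<^sup>2 * (cos (Z x))\<^sup>2 > 0" by (intro add_pos_nonneg) auto
  then show ?thesis
    unfolding auxN_def by (auto intro!: derivative_eq_intros assms simp: field_simps power2_eq_square)
qed

text \<open>The origin of \<open>auxC\<close>: by the quotient rule it is the coefficient of
  \<open>Z'\<close> in the numerator over the common denominator \<open>N ^ 3\<close>.\<close>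

lemma eta_has_derivative:
  assumes "(D has_derivative D') (at x)" "(Z has_derivative Z') (at x)" "cos (Z x) \<noteq> 0"
  shows "((\<lambda>x. eta k2 k3 (D x) (Z x)) has_derivative
    (\<lambda>h. (auxC k2 k3 (D x) (Z x) * Z' h
      - (k3 * sin (Z x) + tan (Z x)) * k2\<^sup>2 * D x * (cos (Z x))\<^sup>2 * D' h) / auxN k2 (D x) (Z x) ^ 3))
    (at x)"
proof -
  define N where "N = auxN k2 (D x) (Z x)"
  define s c d m where "s = sin (Z x)" "c = cos (Z x)" "d = D x" "m = k3 * sin (Z x) + tan (Z x)"
  have N0: "N \<noteq> 0" and N2: "N\<^sup>2 = 1 + k2\<^sup>2 * d\<^sup>2 * c\<^sup>2"
    using auxN_pos[of k2 "D x" "Z x"] auxN_sq[of k2 "D x" "Z x"] by (auto simp: N_def s_c_d_m_def)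
  have c0: "c \<noteq> 0" and sc: "s\<^sup>2 = 1 - c\<^sup>2" using assms by (auto simp: s_c_d_m_def sin_squared_eq)
  \<comment> \<open>The first summand comes from differentiating \<open>k3 * sin + tan\<close>, the
    second from differentiating \<open>N\<close>; their sum has to be matched with the given form of
    \<open>auxC\<close>.\<close>
  have C: "auxC k2 k3 d (Z x) = (k3 * c + 1 / c\<^sup>2) * N\<^sup>2 + m * k2\<^sup>2 * d\<^sup>2 * s * c"
  proof -
    have t: "tan (Z x) = s / c" by (simp add: tan_def s_c_d_m_def)
    have t2: "1 + (s / c)\<^sup>2 = 1 / c\<^sup>2" using c0 sc by (simp add: field_simps)
    have "m * s * c = k3 * c * s\<^sup>2 + s\<^sup>2"
      using c0 by (simp add: s_c_d_m_def tan_def field_simps power2_eq_square)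
    then have m: "m * s * c = k3 * c - k3 * c ^ 3 + 1 - c\<^sup>2"
      unfolding sc by (simp add: algebra_simps power2_eq_square power3_eq_cube)
    have "(k3 * c + 1 / c\<^sup>2) * N\<^sup>2 + m * k2\<^sup>2 * d\<^sup>2 * s * c
        = k3 * c + 1 / c\<^sup>2 + k2\<^sup>2 * d\<^sup>2 * (k3 * c ^ 3 + 1 + m * s * c)"
      unfolding N2 using c0 by (simp add: field_simps power2_eq_square power3_eq_cube)
    also have "\<dots> = auxC k2 k3 d (Z x)"
      unfolding m auxC_def t t2[symmetric] by (simp add: s_c_d_m_def algebra_simps)
    finally show ?thesis ..
  qed
  have "((\<lambda>x. (k3 * sin (Z x) + tan (Z x)) / auxN k2 (D x) (Z x)) has_derivative
    (\<lambda>h. ((k3 * c + 1 / c\<^sup>2) * Z' h * N - m * (k2\<^sup>2 * d * c * (c * D' h - d * s * Z' h) / N)) / (N * N)))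
    (at x)"
    using N0 c0
    by (auto intro!: derivative_eq_intros auxN_has_derivative[OF assms(1,2)] assms
      simp: N_def s_c_d_m_def algebra_simps divide_inverse)
  also have "(\<lambda>h. ((k3 * c + 1 / c\<^sup>2) * Z' h * N - m * (k2\<^sup>2 * d * c * (c * D' h - d * s * Z' h) / N)) / (N * N))
    = (\<lambda>h. (auxC k2 k3 d (Z x) * Z' h - m * k2\<^sup>2 * d * c\<^sup>2 * D' h) / N ^ 3)"
    unfolding C
  proof
    fix h
    have "((k3 * c + 1 / c\<^sup>2) * Z' h * N - m * (k2\<^sup>2 * d * c * (c * D' h - d * s * Z' h) / N)) / (N * N)
       = ((k3 * c + 1 / c\<^sup>2) * Z' h * (N * N) - m * (k2\<^sup>2 * d * c * (c * D' h - d * s * Z' h))) / (N * N * N)"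
      using N0 by (simp add: diff_divide_distrib)
    then show "((k3 * c + 1 / c\<^sup>2) * Z' h * N - m * (k2\<^sup>2 * d * c * (c * D' h - d * s * Z' h) / N)) / (N * N)
      = (((k3 * c + 1 / c\<^sup>2) * N\<^sup>2 + m * k2\<^sup>2 * d\<^sup>2 * s * c) * Z' h - m * k2\<^sup>2 * d * c\<^sup>2 * D' h) / N ^ 3"
      by (simp add: power2_eq_square power3_eq_cube algebra_simps)
  qed
  finally show ?thesis by (simp add: eta_eq N_def s_c_d_m_def)
qed

lemma err1_has_derivative:
  assumes "(D has_derivative D') (at x)" "(G has_derivative G') (at x)" "(Z has_derivative Z') (at x)"
  shows "((\<lambda>x. err1 k2 (D x) (G x) (Z x)) has_derivative
    (\<lambda>h. G' h + k2 * (cos (Z x) * D' h - D x * sin (Z x) * Z' h) / (auxN k2 (D x) (Z x))\<^sup>2)) (at x)"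
  unfolding err1_def auxN_sq
  by (auto intro!: derivative_eq_intros assms simp: power_mult_distrib divide_inverse algebra_simps)

lemma err2_has_derivative:
  assumes "(D has_derivative D') (at x)" "(Z has_derivative Z') (at x)" "(T has_derivative T') (at x)"
    "cos (Z x) \<noteq> 0"
  shows "((\<lambda>x. err2 k2 k3 (D x) (Z x) (T x)) has_derivative
    (\<lambda>h. T' h + (auxC k2 k3 (D x) (Z x) * Z' h
      - (k3 * sin (Z x) + tan (Z x)) * k2\<^sup>2 * D x * (cos (Z x))\<^sup>2 * D' h)
      / (auxN k2 (D x) (Z x) ^ 3 * (auxB k2 k3 (D x) (Z x))\<^sup>2))) (at x)"
proof -
  define E' where "E' h = (auxC k2 k3 (D x) (Z x) * Z' h
      - (k3 * sin (Z x) + tan (Z x)) * k2\<^sup>2 * D x * (cos (Z x))\<^sup>2 * D' h) / auxN k2 (D x) (Z x) ^ 3" for h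
  have "((\<lambda>x. eta k2 k3 (D x) (Z x)) has_derivative E') (at x)"
    unfolding E'_def by (rule eta_has_derivative[OF assms(1,2,4)])
  then have "((\<lambda>x. err2 k2 k3 (D x) (Z x) (T x)) has_derivative
      (\<lambda>h. T' h + E' h / (auxB k2 k3 (D x) (Z x))\<^sup>2)) (at x)"
    unfolding err2_def auxB_sq
    by (auto intro!: derivative_eq_intros assms simp: divide_inverse mult.commute)
  then show ?thesis by (simp add: E'_def)
qed

text \<open>Representing the derivative by a vector makes continuous differentiability a matter of
  regularity of this tuple and turns the derivative along the system into an inner product.\<close>

fun grad_V :: "real \<Rightarrow> real \<Rightarrow> state \<Rightarrow> state" where
  "grad_V k2 k3 (\<rho>, \<delta>, \<gamma>, \<zeta>, \<theta>) =
     (let N = auxN k2 \<delta> \<zeta>; B = auxB k2 k3 \<delta> \<zeta>; C = auxC k2 k3 \<delta> \<zeta>;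
          e1 = err1 k2 \<delta> \<gamma> \<zeta>; e2 = err2 k2 k3 \<delta> \<zeta> \<theta>
      in (\<rho>,
          \<delta> + e1 * (k2 * cos \<zeta> / N\<^sup>2)
            - e2 * ((k3 * sin \<zeta> + tan \<zeta>) * k2\<^sup>2 * \<delta> * (cos \<zeta>)\<^sup>2 / (N ^ 3 * B\<^sup>2)),
          e1,
          tan \<zeta> * (1 / (cos \<zeta>)\<^sup>2) - e1 * (k2 * \<delta> * sin \<zeta> / N\<^sup>2) + e2 * (C / (N ^ 3 * B\<^sup>2)),
          e2))"

lemma half_square_has_derivative:
  fixes f :: "'a::real_normed_vector \<Rightarrow> real"
  assumes "(f has_derivative f') (at x)"
  shows "((\<lambda>x. 1 / 2 * (f x)\<^sup>2) has_derivative (\<lambda>h. f x * f' h)) (at x)"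
  by (auto intro!: derivative_eq_intros assms)

text \<open>Each summand of \<open>lyap_V\<close> is half a square, so its derivative is the
  function times its own derivative; collecting the coefficients of the five components of
  \<open>h\<close> gives the gradient.\<close>

lemma lyap_V_has_derivative:
  assumes "\<bar>fst (snd (snd (snd x)))\<bar> < pi / 2"
  shows "(lyap_V k2 k3 has_derivative (\<lambda>h. h \<bullet> grad_V k2 k3 x)) (at x)"
proof -
  define R D G Z T :: "state \<Rightarrow> real" where
    "R = fst" "D = (\<lambda>x. fst (snd x))" "G = (\<lambda>x. fst (snd (snd x)))"
    "Z = (\<lambda>x. fst (snd (snd (snd x))))" "T = (\<lambda>x. snd (snd (snd (snd x))))"
  note defs = R_D_G_Z_T_def
  have der: "(R has_derivative R) (at x)" "(D has_derivative D) (at x)" "(G has_derivative G) (at x)"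
    "(Z has_derivative Z) (at x)" "(T has_derivative T) (at x)"
    by (auto simp: defs intro!: derivative_eq_intros)
  have c0: "cos (Z x) \<noteq> 0"
    using cos_pos_strip[OF assms] by (simp add: defs)
  have "lyap_V k2 k3 = (\<lambda>x. 1 / 2 * (R x)\<^sup>2 + 1 / 2 * (D x)\<^sup>2 + 1 / 2 * (tan (Z x))\<^sup>2
      + 1 / 2 * (err1 k2 (D x) (G x) (Z x))\<^sup>2 + 1 / 2 * (err2 k2 k3 (D x) (Z x) (T x))\<^sup>2)"
    by (auto simp: fun_eq_iff defs field_simps)
  moreover have "((\<lambda>x. tan (Z x)) has_derivative (\<lambda>h. 1 / (cos (Z x))\<^sup>2 * Z h)) (at x)"
    using c0 by (auto intro!: derivative_eq_intros der simp: divide_inverse)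
  then have "((\<lambda>x. 1 / 2 * (R x)\<^sup>2 + 1 / 2 * (D x)\<^sup>2 + 1 / 2 * (tan (Z x))\<^sup>2
      + 1 / 2 * (err1 k2 (D x) (G x) (Z x))\<^sup>2 + 1 / 2 * (err2 k2 k3 (D x) (Z x) (T x))\<^sup>2) has_derivative
    (\<lambda>h. R x * R h + D x * D h + tan (Z x) * (1 / (cos (Z x))\<^sup>2 * Z h)
      + err1 k2 (D x) (G x) (Z x) *
        (G h + k2 * (cos (Z x) * D h - D x * sin (Z x) * Z h) / (auxN k2 (D x) (Z x))\<^sup>2)
      + err2 k2 k3 (D x) (Z x) (T x) * (T h + (auxC k2 k3 (D x) (Z x) * Z h
      - (k3 * sin (Z x) + tan (Z x)) * k2\<^sup>2 * D x * (cos (Z x))\<^sup>2 * D h)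
      / (auxN k2 (D x) (Z x) ^ 3 * (auxB k2 k3 (D x) (Z x))\<^sup>2)))) (at x)"
    by (intro has_derivative_add half_square_has_derivative err1_has_derivative err2_has_derivative der c0)
  moreover have "(\<lambda>h. R x * R h + D x * D h + tan (Z x) * (1 / (cos (Z x))\<^sup>2 * Z h)
      + err1 k2 (D x) (G x) (Z x) *
        (G h + k2 * (cos (Z x) * D h - D x * sin (Z x) * Z h) / (auxN k2 (D x) (Z x))\<^sup>2)
      + err2 k2 k3 (D x) (Z x) (T x) * (T h + (auxC k2 k3 (D x) (Z x) * Z h
      - (k3 * sin (Z x) + tan (Z x)) * k2\<^sup>2 * D x * (cos (Z x))\<^sup>2 * D h)
      / (auxN k2 (D x) (Z x) ^ 3 * (auxB k2 k3 (D x) (Z x))\<^sup>2))) = (\<lambda>h. h \<bullet> grad_V k2 k3 x)"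
  proof
    fix h :: state
    obtain a b c d e where h: "h = (a, b, c, d, e)" by (cases h)
    obtain r q g z t where x: "x = (r, q, g, z, t)" by (cases x)
    show "R x * R h + D x * D h + tan (Z x) * (1 / (cos (Z x))\<^sup>2 * Z h)
      + err1 k2 (D x) (G x) (Z x) *
        (G h + k2 * (cos (Z x) * D h - D x * sin (Z x) * Z h) / (auxN k2 (D x) (Z x))\<^sup>2)
      + err2 k2 k3 (D x) (Z x) (T x) * (T h + (auxC k2 k3 (D x) (Z x) * Z h
      - (k3 * sin (Z x) + tan (Z x)) * k2\<^sup>2 * D x * (cos (Z x))\<^sup>2 * D h)
      / (auxN k2 (D x) (Z x) ^ 3 * (auxB k2 k3 (D x) (Z x))\<^sup>2)) = h \<bullet> grad_V k2 k3 x"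
      by (simp add: h x defs Let_def divide_inverse algebra_simps)
  qed
  ultimately show ?thesis by simp
qed

section \<open>Splitting of the angles and the closed-loop identity\<close>

text \<open>The special value of \<open>sigma1\<close> at zero error does not matter here, since it
  is multiplied by \<open>e = 0\<close>.\<close>

lemma sin_eq_sigma1: "sin b = e * sigma1 e b - sin (e - b)"
  by (simp add: sigma1_def)

lemma cos_eq_sigma2: "cos b = e * sigma2 e b + cos (e - b)"
  by (simp add: sigma2_def)

text \<open>The difference \<open>e - \<gamma>\<close> is an arctangent, so its sine and cosine are
  algebraic, with \<open>N\<close> as the square root that occurs.\<close>

lemma sin_cos_gamma:
  fixes k2 \<delta> \<gamma> \<zeta> :: real
  defines "N \<equiv> auxN k2 \<delta> \<zeta>" and "e \<equiv> err1 k2 \<delta> \<gamma> \<zeta>"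
  shows "sin \<gamma> = e * sigma1 e \<gamma> - k2 * \<delta> * cos \<zeta> / N" "cos \<gamma> = e * sigma2 e \<gamma> + 1 / N"
proof -
  have e: "e - \<gamma> = arctan (k2 * \<delta> * cos \<zeta>)" by (simp add: e_def err1_def)
  show "sin \<gamma> = e * sigma1 e \<gamma> - k2 * \<delta> * cos \<zeta> / N"
    by (subst sin_eq_sigma1[of \<gamma> e]) (simp add: e sin_arctan N_def auxN_def power_mult_distrib)
  show "cos \<gamma> = e * sigma2 e \<gamma> + 1 / N"
    by (subst cos_eq_sigma2[of \<gamma> e]) (simp add: e cos_arctan N_def auxN_def power_mult_distrib)
qed

lemma sin_cos_theta:
  fixes k2 k3 \<delta> \<zeta> \<theta> :: real
  defines "B \<equiv> auxB k2 k3 \<delta> \<zeta>" and "e \<equiv> err2 k2 k3 \<delta> \<zeta> \<theta>"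
  shows "sin \<theta> = e * sigma1 e \<theta> - eta k2 k3 \<delta> \<zeta> / B" "cos \<theta> = e * sigma2 e \<theta> + 1 / B"
proof -
  have e: "e - \<theta> = arctan (eta k2 k3 \<delta> \<zeta>)" by (simp add: e_def err2_def)
  show "sin \<theta> = e * sigma1 e \<theta> - eta k2 k3 \<delta> \<zeta> / B"
    by (subst sin_eq_sigma1[of \<theta> e]) (simp add: e sin_arctan B_def auxB_def)
  show "cos \<theta> = e * sigma2 e \<theta> + 1 / B"
    by (subst cos_eq_sigma2[of \<theta> e]) (simp add: e cos_arctan B_def auxB_def)
qed

text \<open>Trigonometric quantities are replaced by letters tied together by \<open>sc\<close>,
  \<open>mt\<close>, \<open>sg\<close>, \<open>cg\<close>, \<open>st\<close> and \<open>ct\<close>.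
  The remaining rational identity is checked separately for the \<open>\<rho>\<close>,
  \<open>\<delta>\<close> and \<open>\<zeta>\<close> contributions.\<close>

lemma grad_V_closed_loop:
  fixes k1 k2 k3 k4 k5 \<rho> \<delta> \<gamma> \<zeta> \<theta> :: real
  assumes "\<bar>\<zeta>\<bar> < pi / 2"
  defines "x \<equiv> (\<rho>, \<delta>, \<gamma>, \<zeta>, \<theta>)"
  shows "sys_rhs_ext (k1 * auxN k2 \<delta> \<zeta> * auxB k2 k3 \<delta> \<zeta>) (q_fb k1 k2 k3 k5 x) (rt_fb k1 k2 k3 k4 x) x
      \<bullet> grad_V k2 k3 x
    = - k1 * \<rho>\<^sup>2 * (k3 * (sin \<zeta>)\<^sup>2 + 1 / cos \<zeta>) - k1 * k2 * \<delta>\<^sup>2 - k1 * k3 * (tan \<zeta>)\<^sup>2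
      - k4 * (err1 k2 \<delta> \<gamma> \<zeta>)\<^sup>2 - k5 * (err2 k2 k3 \<delta> \<zeta> \<theta>)\<^sup>2"
proof -
  define N B C where "N = auxN k2 \<delta> \<zeta>" "B = auxB k2 k3 \<delta> \<zeta>" "C = auxC k2 k3 \<delta> \<zeta>"
  define e1 e2 where "e1 = err1 k2 \<delta> \<gamma> \<zeta>" "e2 = err2 k2 k3 \<delta> \<zeta> \<theta>"
  define s c m t where "s = sin \<zeta>" "c = cos \<zeta>" "m = k3 * sin \<zeta> + tan \<zeta>" "t = tan \<zeta>"
  define sg cg st ct where "sg = sin \<gamma>" "cg = cos \<gamma>" "st = sin \<theta>" "ct = cos \<theta>"
  define g1 g2 h1 h2 where "g1 = sigma1 e1 \<gamma>" "g2 = sigma2 e1 \<gamma>" "h1 = sigma1 e2 \<theta>" "h2 = sigma2 e2 \<theta>"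
  note defs = N_B_C_def e1_e2_def s_c_m_t_def sg_cg_st_ct_def g1_g2_h1_h2_def
  have N0: "N \<noteq> 0" and B0: "B \<noteq> 0"
    using auxN_pos[of k2 \<delta> \<zeta>] auxB_pos[of k2 k3 \<delta> \<zeta>] by (auto simp: defs)
  have c0: "c \<noteq> 0" using cos_pos_strip[OF assms(1)] by (simp add: defs)
  have sc: "s\<^sup>2 + c\<^sup>2 = 1" by (simp add: defs)
  have mt: "m = k3 * s + s / c" "t = s / c" by (simp_all add: defs tan_def)
  have sg: "sg - e1 * g1 = - (k2 * \<delta> * c / N)" and cg: "cg - e1 * g2 = 1 / N"
    using sin_cos_gamma[of \<gamma> k2 \<delta> \<zeta>] by (simp_all add: defs)
  have st: "N * B * (st - e2 * h1) = - m" and ct: "B * ct = 1 + B * e2 * h2"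
    using sin_cos_theta[of \<theta> k2 k3 \<delta> \<zeta>] N0 B0 by (simp_all add: defs eta_eq field_simps)

  \<comment> \<open>With this input \<open>d'\<close> is the rate of \<open>\<delta>\<close> and
    \<open>k1 * N * B * P\<close> the rate of \<open>\<zeta>\<close>.\<close>
  define P where "P = ct * s * cg + st * c"
  define d' where "d' = k1 * N * B * ct / c * sg"
  define rt where "rt = rt_fb k1 k2 k3 k4 x"
  define q where "q = q_fb k1 k2 k3 k5 x"
  \<comment> \<open>The left side is the rate of \<open>e1\<close>. The feedforward part of
    \<open>rt\<close> cancels the drift, and the factors \<open>1 + e2 * h2 * B\<close> of the
    feedback are recognised as \<open>B * ct\<close>.\<close>
  have rt: "d' - rt + k2 * (c * d' - \<delta> * s * (k1 * N * B * P)) / N\<^sup>2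
      = - k4 * e1 + k1 * \<rho>\<^sup>2 * c * N * (g2 * (B * ct)) - k1 * \<delta> * g1 * N / c * (B * ct)
        - k1 * t * N / c\<^sup>2 * s * (g2 * (B * ct))"
  proof -
    have P: "ct * s\<^sup>2 * cg + st * sin (2 * \<zeta>) / 2 = s * P"
      unfolding sin_double by (simp add: P_def defs algebra_simps power2_eq_square)
    have rt_eq: "rt = k4 * e1 + d' + k1 * k2 * B / N * (ct * sg - \<delta> * (s * P))
      - k1 * \<rho>\<^sup>2 * c * N * (g2 * (B * ct)) + k1 * \<delta> * g1 * N / c * (B * ct)
        + k1 * t * N / c\<^sup>2 * s * (g2 * (B * ct))"
      unfolding ct P[symmetric]
      by (simp add: rt_def x_def Let_def defs d'_def algebra_simps add_divide_distrib)
    have "k2 * (c * d' - \<delta> * s * (k1 * N * B * P)) / N\<^sup>2 = k1 * k2 * B / N * (ct * sg - \<delta> * (s * P))"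
      using N0 c0 by (simp add: d'_def field_simps power2_eq_square)
    then show ?thesis by (simp add: rt_eq algebra_simps)
  qed
  \<comment> \<open>The left side is the rate of \<open>e2\<close>; the bracket with
    \<open>C\<close> in the feedback is exactly the negative of the drift caused by
    \<open>eta\<close>.\<close>
  have q: "q + (C * (k1 * N * B * P) - m * k2\<^sup>2 * \<delta> * c\<^sup>2 * d') / (N ^ 3 * B\<^sup>2)
      = - k5 * e2 + k1 * k2 * \<delta>\<^sup>2 * h2 * B - k1 * \<rho>\<^sup>2 * B * (s * h1 * N - c * h2)
        - k1 * t * B / c\<^sup>2 * (s * h2 + c * h1 * N)"
  proof -
    have q_eq: "q = - k5 * e2 + k1 * k2 * \<delta>\<^sup>2 * h2 * B
        + k1 / (N\<^sup>2 * B) * (k2\<^sup>2 * \<delta> * ct * c * sg * m - P * C)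
        - k1 * \<rho>\<^sup>2 * B * (s * h1 * N - c * h2)
        - k1 * t * B / c\<^sup>2 * (s * h2 + c * h1 * N)"
      by (simp add: q_def x_def Let_def defs P_def)
    have "(C * (k1 * N * B * P) - m * k2\<^sup>2 * \<delta> * c\<^sup>2 * d') / (N ^ 3 * B\<^sup>2)
        = k1 / (N\<^sup>2 * B) * (P * C - k2\<^sup>2 * \<delta> * ct * c * sg * m)"
      using N0 B0 c0 by (simp add: d'_def field_simps power2_eq_square power3_eq_cube)
    then show ?thesis by (simp add: q_eq algebra_simps)
  qed

  \<comment> \<open>The feedback terms complete \<open>st\<close> and \<open>cg\<close> to
    \<open>st - e2 * h1\<close> and \<open>cg - e1 * g2\<close>, whose values are known; the
    leftover \<open>e2 * h2\<close> cancels against the one in \<open>B * ct\<close>.\<close>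
  have rho_terms: "k1 * N * B * \<rho>\<^sup>2 * (st * s - ct * c * cg) + e1 * (k1 * \<rho>\<^sup>2 * c * N * (g2 * (B * ct)))
      - e2 * (k1 * \<rho>\<^sup>2 * B * (s * h1 * N - c * h2)) = - k1 * \<rho>\<^sup>2 * (k3 * s\<^sup>2 + 1 / c)"
  proof -
    have "k1 * N * B * \<rho>\<^sup>2 * (st * s - ct * c * cg) + e1 * (k1 * \<rho>\<^sup>2 * c * N * (g2 * (B * ct)))
      - e2 * (k1 * \<rho>\<^sup>2 * B * (s * h1 * N - c * h2))
      = k1 * \<rho>\<^sup>2 * (s * (N * B * (st - e2 * h1)) - c * (B * ct) * (N * (cg - e1 * g2)) + c * B * e2 * h2)"
      by (simp add: algebra_simps)
    also have "\<dots> = k1 * \<rho>\<^sup>2 * (- (s * m) - c)"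
      unfolding st ct cg using N0 by (simp add: algebra_simps)
    \<comment> \<open>Here \<open>s * m = k3 * s\<^sup>2 + s\<^sup>2 / c\<close>, and
      \<open>s\<^sup>2 / c + c = 1 / c\<close>.\<close>
    also have "- (s * m) - c = - (k3 * s\<^sup>2 + 1 / c)"
      using c0 by (simp add: mt flip: sc) (simp add: field_simps power2_eq_square)
    also have "k1 * \<rho>\<^sup>2 * - (k3 * s\<^sup>2 + 1 / c) = - k1 * \<rho>\<^sup>2 * (k3 * s\<^sup>2 + 1 / c)"
      by (metis minus_mult_commute mult_minus_left)
    finally show ?thesis .
  qed
  have delta_terms: "\<delta> * d' - e1 * (k1 * \<delta> * g1 * N / c * (B * ct)) + e2 * (k1 * k2 * \<delta>\<^sup>2 * h2 * B)
      = - k1 * k2 * \<delta>\<^sup>2"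
  proof -
    have "\<delta> * d' - e1 * (k1 * \<delta> * g1 * N / c * (B * ct)) + e2 * (k1 * k2 * \<delta>\<^sup>2 * h2 * B)
      = k1 * \<delta> / c * (B * ct) * (N * (sg - e1 * g1)) + k1 * k2 * \<delta>\<^sup>2 * (B * e2 * h2)"
      by (simp add: d'_def algebra_simps diff_divide_distrib)
    also have "\<dots> = - k1 * k2 * \<delta>\<^sup>2"
      unfolding sg ct using N0 c0 by (simp add: field_simps power2_eq_square)
    finally show ?thesis .
  qed
  have zeta_terms: "t * (1 / c\<^sup>2) * (k1 * N * B * P) - e1 * (k1 * t * N / c\<^sup>2 * s * (g2 * (B * ct)))
      - e2 * (k1 * t * B / c\<^sup>2 * (s * h2 + c * h1 * N)) = - k1 * k3 * t\<^sup>2"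
  proof -
    have "t * (1 / c\<^sup>2) * (k1 * N * B * P) - e1 * (k1 * t * N / c\<^sup>2 * s * (g2 * (B * ct)))
      - e2 * (k1 * t * B / c\<^sup>2 * (s * h2 + c * h1 * N))
      = k1 * t / c\<^sup>2 * ((B * ct) * s * (N * (cg - e1 * g2)) + c * (N * B * (st - e2 * h1)) - s * B * e2 * h2)"
      by (simp add: P_def algebra_simps add_divide_distrib diff_divide_distrib)
    also have "\<dots> = k1 * t / c\<^sup>2 * (s - c * m)"
      unfolding st ct cg using N0 by (simp add: algebra_simps)
    also have "\<dots> = - k1 * k3 * t\<^sup>2"
      using c0 by (simp add: mt field_simps power2_eq_square)
    finally show ?thesis .
  qed

  have "sys_rhs_ext (k1 * auxN k2 \<delta> \<zeta> * auxB k2 k3 \<delta> \<zeta>) (q_fb k1 k2 k3 k5 x) (rt_fb k1 k2 k3 k4 x) x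
      \<bullet> grad_V k2 k3 x
    = k1 * N * B * \<rho>\<^sup>2 * (st * s - ct * c * cg) + \<delta> * d' + t * (1 / c\<^sup>2) * (k1 * N * B * P)
      + e1 * (d' - rt + k2 * (c * d' - \<delta> * s * (k1 * N * B * P)) / N\<^sup>2)
      + e2 * (q + (C * (k1 * N * B * P) - m * k2\<^sup>2 * \<delta> * c\<^sup>2 * d') / (N ^ 3 * B\<^sup>2))"
  proof -
    have "sys_rhs_ext (k1 * auxN k2 \<delta> \<zeta> * auxB k2 k3 \<delta> \<zeta>) (q_fb k1 k2 k3 k5 x) (rt_fb k1 k2 k3 k4 x) x
      = (\<rho> * (k1 * N * B) * (st * s - ct * c * cg), d', d' - rt, k1 * N * B * P, q)"
      unfolding rt_def[symmetric] q_def[symmetric]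
      by (simp add: x_def d'_def P_def defs)
    moreover have "grad_V k2 k3 x = (\<rho>, \<delta> + e1 * (k2 * c / N\<^sup>2) - e2 * (m * k2\<^sup>2 * \<delta> * c\<^sup>2 / (N ^ 3 * B\<^sup>2)), e1,
      t * (1 / c\<^sup>2) - e1 * (k2 * \<delta> * s / N\<^sup>2) + e2 * (C / (N ^ 3 * B\<^sup>2)), e2)"
      by (simp add: x_def defs Let_def)
    ultimately show ?thesis
      by (simp only: inner_Pair inner_real_def)
        (simp add: divide_inverse algebra_simps power2_eq_square)
  qed
  \<comment> \<open>The error rates are inserted and their cross terms moved to the coordinate they
    belong to; only the two damping terms stay apart.\<close>
  also have "\<dots> = (k1 * N * B * \<rho>\<^sup>2 * (st * s - ct * c * cg) + e1 * (k1 * \<rho>\<^sup>2 * c * N * (g2 * (B * ct)))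
      - e2 * (k1 * \<rho>\<^sup>2 * B * (s * h1 * N - c * h2)))
      + (\<delta> * d' - e1 * (k1 * \<delta> * g1 * N / c * (B * ct)) + e2 * (k1 * k2 * \<delta>\<^sup>2 * h2 * B))
      + (t * (1 / c\<^sup>2) * (k1 * N * B * P) - e1 * (k1 * t * N / c\<^sup>2 * s * (g2 * (B * ct)))
      - e2 * (k1 * t * B / c\<^sup>2 * (s * h2 + c * h1 * N))) - k4 * e1\<^sup>2 - k5 * e2\<^sup>2"
    unfolding rt q by (simp only: right_diff_distrib distrib_left power2_eq_square) simp
  also have "\<dots> = - k1 * \<rho>\<^sup>2 * (k3 * s\<^sup>2 + 1 / c) - k1 * k2 * \<delta>\<^sup>2 - k1 * k3 * t\<^sup>2 - k4 * e1\<^sup>2 - k5 * e2\<^sup>2"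
    unfolding rho_terms delta_terms zeta_terms by simp
  finally show ?thesis by (simp add: defs)
qed

subsection \<open>Regularity and size estimates\<close>

lemma loc_lip_auxN: "loc_lip d x \<Longrightarrow> loc_lip z x \<Longrightarrow> loc_lip (\<lambda>x. auxN k2 (d x) (z x)) x"
  unfolding auxN_def by (intro loc_lip_intros add_pos_nonneg) auto

lemma loc_lip_eta:
  "loc_lip d x \<Longrightarrow> loc_lip z x \<Longrightarrow> cos (z x) \<noteq> 0 \<Longrightarrow> loc_lip (\<lambda>x. eta k2 k3 (d x) (z x)) x"
  unfolding eta_eq using auxN_pos[of k2 "d x" "z x"]
  by (intro loc_lip_intros loc_lip_auxN) auto

lemma loc_lip_auxB:
  "loc_lip d x \<Longrightarrow> loc_lip z x \<Longrightarrow> cos (z x) \<noteq> 0 \<Longrightarrow> loc_lip (\<lambda>x. auxB k2 k3 (d x) (z x)) x"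
  unfolding auxB_def by (intro loc_lip_intros loc_lip_eta add_pos_nonneg) auto

lemma loc_lip_auxC:
  "loc_lip d x \<Longrightarrow> loc_lip z x \<Longrightarrow> cos (z x) \<noteq> 0 \<Longrightarrow> loc_lip (\<lambda>x. auxC k2 k3 (d x) (z x)) x"
  unfolding auxC_def by (intro loc_lip_intros) auto

lemma loc_lip_err1:
  "loc_lip d x \<Longrightarrow> loc_lip g x \<Longrightarrow> loc_lip z x \<Longrightarrow> loc_lip (\<lambda>x. err1 k2 (d x) (g x) (z x)) x"
  unfolding err1_def by (intro loc_lip_intros)

lemma loc_lip_err2:
  "loc_lip d x \<Longrightarrow> loc_lip z x \<Longrightarrow> loc_lip t x \<Longrightarrow> cos (z x) \<noteq> 0 \<Longrightarrow>
    loc_lip (\<lambda>x. err2 k2 k3 (d x) (z x) (t x)) x"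
  unfolding err2_def by (intro loc_lip_intros loc_lip_eta)

lemma loc_lip_sigma:
  assumes "loc_lip a x" "loc_lip b x"
  shows "loc_lip (\<lambda>x. sigma1 (a x) (b x)) x" "loc_lip (\<lambda>x. sigma2 (a x) (b x)) x"
  unfolding sigma1_eq_sinc sigma2_eq_sinc by (intro loc_lip_intros assms; simp)+

lemmas loc_lip_fb_intros = loc_lip_intros loc_lip_auxN loc_lip_auxB loc_lip_auxC
  loc_lip_err1 loc_lip_err2 loc_lip_sigma

text \<open>Functions defined by pattern matching on tuples do not unfold at a variable; replacing
  it by the tuple of its projections makes their equations applicable under the binder.\<close>

lemma state_eta:
  "f = (\<lambda>x. f (fst x, fst (snd x), fst (snd (snd x)), fst (snd (snd (snd x))), snd (snd (snd (snd x)))))"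
  for f :: "state \<Rightarrow> 'a"
  by simp

lemma loc_lip_feedback:
  assumes "cos (fst (snd (snd (snd x)))) \<noteq> 0"
  shows "loc_lip (v_fb k1 k2 k3) x" "loc_lip (q_fb k1 k2 k3 k5) x" "loc_lip (rt_fb k1 k2 k3 k4) x"
    "loc_lip (grad_V k2 k3) x"
  using auxN_pos[THEN less_imp_neq, THEN not_sym] auxB_pos[THEN less_imp_neq, THEN not_sym] assms
  by (subst state_eta, unfold v_fb.simps q_fb.simps rt_fb.simps grad_V.simps Let_def,
      intro loc_lip_fb_intros; simp)+

lemma loc_lip_sys_rhs:
  assumes "cos (fst (snd (snd (snd x)))) \<noteq> 0" "fst x \<noteq> 0" "loc_lip v x" "loc_lip q x" "loc_lip rt x"
  shows "loc_lip (\<lambda>x. sys_rhs (v x) (q x) (rt x) x) x"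
proof -
  have "(\<lambda>x. sys_rhs (v x) (q x) (rt x) x) = (\<lambda>x. sys_rhs (v x) (q x) (rt x)
     (fst x, fst (snd x), fst (snd (snd x)), fst (snd (snd (snd x))), snd (snd (snd (snd x)))))"
    by simp
  then show ?thesis
    by (rule ssubst) (unfold sys_rhs.simps, intro loc_lip_intros assms; use assms in simp)
qed

section \<open>The metric of the state space against the Euclidean one\<close>

lemma abs_arctan_diff_le: "\<bar>arctan x - arctan y\<bar> \<le> \<bar>x - y\<bar>"
proof -
  have "norm (arctan x - arctan y) \<le> 1 * norm (x - y)"
  proof (rule field_differentiable_bound[of UNIV arctan "\<lambda>x. inverse (1 + x\<^sup>2)"])
    show "(arctan has_field_derivative inverse (1 + z\<^sup>2)) (at z within UNIV)" for z
      by (rule DERIV_arctan)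
    show "norm (inverse (1 + z\<^sup>2)) \<le> 1" for z :: real
      by (simp add: inverse_le_1_iff)
  qed auto
  then show ?thesis by simp
qed

lemma abs_arctan_le: "\<bar>arctan x\<bar> \<le> \<bar>x\<bar>"
  using abs_arctan_diff_le[of x 0] by simp

lemma arctan_tan_strip: "\<bar>\<zeta>\<bar> < pi / 2 \<Longrightarrow> arctan (tan \<zeta>) = \<zeta>"
  by (rule arctan_tan) (simp_all only: abs_less_iff, linarith+)

text \<open>On the strip \<open>arctan\<close> inverts \<open>tan\<close> and is 1-Lipschitz, so
  passing to tangents can only increase distances; the Euclidean norm is at most the sum
  norm.\<close>

lemma dist_le_dist_D:
  assumes "x \<in> state_D" "y \<in> state_D"
  shows "dist x y \<le> dist_D x y"
proof -
  obtain a b c d e where x: "x = (a, b, c, d, e)" by (cases x)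
  obtain a' b' c' d' e' where y: "y = (a', b', c', d', e')" by (cases y)
  have tri: "dist (u, w) (u', w') \<le> dist u u' + dist w w'"
    for u u' :: real and w w' :: "'b::metric_space"
    unfolding dist_Pair_Pair by (rule sqrt_sum_squares_le_sum) auto
  have "dist d d' \<le> \<bar>tan d - tan d'\<bar>"
    using abs_arctan_diff_le[of "tan d" "tan d'"] assms
    by (simp add: arctan_tan_strip dist_real_def state_D_def x y)
  then have "dist x y \<le> dist a a' + (dist b b' + (dist c c' + (\<bar>tan d - tan d'\<bar> + dist e e')))"
    unfolding x y
    by (intro order_trans[OF tri] add_mono order_refl | assumption)+
  then show ?thesis by (simp add: x y dist_real_def)
qed

text \<open>Every Euclidean ball around a point contains, within \<open>state_D\<close>, the
  \<open>dist_D\<close> ball of the same radius, so Euclidean continuity suffices.\<close>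

lemma continuous_map_state_D:
  assumes "\<And>x. x \<in> state_D \<Longrightarrow> isCont f x"
  shows "continuous_map (Metric_space.mtopology state_D dist_D) euclidean f"
  unfolding Metric_space.continuous_map_from_metric[OF Metric_space_D]
proof (intro conjI ballI allI impI)
  fix a U assume a: "a \<in> state_D" and "openin euclidean U \<and> f a \<in> U"
  then have "open U" "f a \<in> U" by auto
  then obtain e where e: "e > 0" "\<And>x. dist x a < e \<Longrightarrow> f x \<in> U"
    using assms[OF a] unfolding continuous_at_open open_dist by (metis dist_self)
  show "\<exists>r>0. \<forall>x. x \<in> state_D \<and> dist_D a x < r \<longrightarrow> f x \<in> U"
    using e dist_le_dist_D[OF a] by (metis dist_commute le_less_trans)
qed simp

lemma open_state_D: "open state_D"
proof -
  have eq: "state_D = {0<..} \<times> UNIV \<times> UNIV \<times> {- (pi / 2)<..<pi / 2} \<times> UNIV"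
    by (auto simp: state_D_def abs_less_iff)
  show ?thesis
    unfolding eq by (intro open_Times open_greaterThan open_UNIV open_greaterThanLessThan)
qed

text \<open>A Gronwall argument: \<open>g t * exp (l * (t - a))\<close> has nonpositive derivative.
  No sign of \<open>g\<close> is assumed, so the lemma also serves for a lower bound on
  \<open>\<rho>\<close>, through its negative.\<close>

lemma exp_decay:
  fixes g :: "real \<Rightarrow> real"
  assumes "is_interval J" "a \<in> J" "b \<in> J" "a \<le> b"
    and g: "\<And>t. t \<in> J \<Longrightarrow> (g has_real_derivative g' t) (at t within J)"
    and g': "\<And>t. t \<in> J \<Longrightarrow> g' t \<le> - l * g t"
  shows "g b \<le> g a * exp (- l * (b - a))"
proof -
  have sub: "{a..b} \<subseteq> J"
    using assms(1-3) unfolding is_interval_1 by (meson atLeastAtMost_iff subsetI)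
  let ?h = "\<lambda>t. g t * exp (l * (t - a))" and ?h' = "\<lambda>t. (g' t + l * g t) * exp (l * (t - a))"
  have "\<exists>t\<in>{a..b}. ?h b - ?h a = ?h' t * (b - a)"
  proof (rule mvt_very_simple[OF \<open>a \<le> b\<close>])
    fix t assume "a \<le> t" "t \<le> b"
    then have "(g has_real_derivative g' t) (at t within {a..b})"
      using sub by (intro DERIV_subset[OF g]) auto
    then have "(?h has_real_derivative ?h' t) (at t within {a..b})"
      by (auto intro!: derivative_eq_intros simp: algebra_simps)
    then show "(?h has_derivative (*) (?h' t)) (at t within {a..b})"
      by (rule has_field_derivative_imp_has_derivative)
  qed
  then obtain t where t: "t \<in> {a..b}" "?h b - ?h a = ?h' t * (b - a)" by blast
  have "?h' t * (b - a) \<le> 0"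
    using g'[of t] t(1) sub \<open>a \<le> b\<close> by (intro mult_nonpos_nonneg) auto
  then have "g b * exp (l * (b - a)) \<le> g a" using t(2) by simp
  then have "g b * exp (l * (b - a)) * exp (- l * (b - a)) \<le> g a * exp (- l * (b - a))"
    by (intro mult_right_mono) auto
  then show ?thesis by (simp add: mult.assoc flip: exp_add)
qed

section \<open>Comparison of \<open>lyap_V\<close> with \<open>size_D\<close>\<close>

lemma abs_eta_le:
  assumes "k3 > 0" "cos \<zeta> > 0"
  shows "\<bar>eta k2 k3 \<delta> \<zeta>\<bar> \<le> (k3 + 1) * \<bar>tan \<zeta>\<bar>"
proof -
  have "\<bar>sin \<zeta>\<bar> = \<bar>tan \<zeta>\<bar> * cos \<zeta>" using assms by (simp add: tan_def abs_mult)
  also have "\<dots> \<le> \<bar>tan \<zeta>\<bar>" by (simp add: mult_left_le)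
  finally have "\<bar>k3 * sin \<zeta>\<bar> \<le> k3 * \<bar>tan \<zeta>\<bar>" using assms by (simp add: abs_mult)
  then have "\<bar>k3 * sin \<zeta> + tan \<zeta>\<bar> \<le> (k3 + 1) * \<bar>tan \<zeta>\<bar>"
    by (simp add: algebra_simps)
  moreover have "\<bar>eta k2 k3 \<delta> \<zeta>\<bar> \<le> \<bar>k3 * sin \<zeta> + tan \<zeta>\<bar>"
    using auxN_ge_1[of k2 \<delta> \<zeta>] by (simp add: eta_eq abs_divide divide_le_eq mult_le_cancel_left1)
  ultimately show ?thesis by linarith
qed

lemma abs_err1_diff_le:
  assumes "k2 > 0"
  shows "\<bar>err1 k2 \<delta> \<gamma> \<zeta> - \<gamma>\<bar> \<le> k2 * \<bar>\<delta>\<bar>"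
proof -
  have "\<bar>arctan (k2 * \<delta> * cos \<zeta>)\<bar> \<le> k2 * \<bar>\<delta>\<bar> * \<bar>cos \<zeta>\<bar>"
    using abs_arctan_le[of "k2 * \<delta> * cos \<zeta>"] assms by (simp add: abs_mult)
  also have "\<dots> \<le> k2 * \<bar>\<delta>\<bar>" using assms by (intro mult_left_le) auto
  finally show ?thesis by (simp add: err1_def)
qed

lemma abs_err2_diff_le:
  assumes "k3 > 0" "cos \<zeta> > 0"
  shows "\<bar>err2 k2 k3 \<delta> \<zeta> \<theta> - \<theta>\<bar> \<le> (k3 + 1) * \<bar>tan \<zeta>\<bar>"
  using order_trans[OF abs_arctan_le abs_eta_le[OF assms]] by (simp add: err2_def)

lemma sum5_squares:
  fixes a b c d e :: real
  shows "(a + b + c + d + e)\<^sup>2 \<le> 5 * (a\<^sup>2 + b\<^sup>2 + c\<^sup>2 + d\<^sup>2 + e\<^sup>2)"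
proof -
  have "5 * (a\<^sup>2 + b\<^sup>2 + c\<^sup>2 + d\<^sup>2 + e\<^sup>2) - (a + b + c + d + e)\<^sup>2
    = (a - b)\<^sup>2 + (a - c)\<^sup>2 + (a - d)\<^sup>2 + (a - e)\<^sup>2 + (b - c)\<^sup>2 + (b - d)\<^sup>2 + (b - e)\<^sup>2
      + (c - d)\<^sup>2 + (c - e)\<^sup>2 + (d - e)\<^sup>2"
    by (simp add: power2_eq_square algebra_simps)
  also have "\<dots> \<ge> 0" by (intro add_nonneg_nonneg) auto
  finally show ?thesis by simp
qed

lemma squares_le_sum5:
  fixes a b c d e :: real
  assumes "a \<ge> 0" "b \<ge> 0" "c \<ge> 0" "d \<ge> 0" "e \<ge> 0"
  shows "a\<^sup>2 + b\<^sup>2 + c\<^sup>2 + d\<^sup>2 + e\<^sup>2 \<le> (a + b + c + d + e)\<^sup>2"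
proof -
  have two: "u\<^sup>2 + v\<^sup>2 \<le> (u + v)\<^sup>2" if "u \<ge> 0" "v \<ge> 0" for u v :: real
    using that by (simp add: power2_sum)
  show ?thesis
    using two[of a b] two[of "a + b" c] two[of "a + b + c" d] two[of "a + b + c + d" e] assms by simp
qed

text \<open>Exchanging the angles for the errors costs at most
  \<open>k2 * \<bar>\<delta>\<bar>\<close> and \<open>(k3 + 1) * \<bar>tan \<zeta>\<bar>\<close>, so
  \<open>S\<close> and \<open>size_D\<close> agree up to the factor \<open>m\<close>, while the
  square of \<open>S\<close> lies between \<open>2 * V\<close> and \<open>10 * V\<close>.\<close>

lemma lyap_V_bounds:
  assumes k: "k2 > 0" "k3 > 0" and x: "x \<in> state_Sigma"
  defines "m \<equiv> 2 + k2 + k3"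
  shows "(size_D x)\<^sup>2 \<le> 10 * m\<^sup>2 * lyap_V k2 k3 x" "lyap_V k2 k3 x \<le> m\<^sup>2 * (size_D x)\<^sup>2 / 2"
proof -
  obtain \<rho> \<delta> \<gamma> \<zeta> \<theta> where xe: "x = (\<rho>, \<delta>, \<gamma>, \<zeta>, \<theta>)" by (cases x)
  have \<rho>: "\<rho> \<ge> 0" and c: "cos \<zeta> > 0"
    using x cos_pos_strip by (auto simp: xe state_Sigma_def)
  define e1 e2 where "e1 = err1 k2 \<delta> \<gamma> \<zeta>" "e2 = err2 k2 k3 \<delta> \<zeta> \<theta>"
  have d1: "\<bar>e1 - \<gamma>\<bar> \<le> k2 * \<bar>\<delta>\<bar>" and d2: "\<bar>e2 - \<theta>\<bar> \<le> (k3 + 1) * \<bar>tan \<zeta>\<bar>"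
    using abs_err1_diff_le[OF k(1)] abs_err2_diff_le[OF k(2) c] by (auto simp: e1_e2_def)
  have d: "\<bar>\<gamma>\<bar> \<le> \<bar>e1\<bar> + k2 * \<bar>\<delta>\<bar>" "\<bar>\<theta>\<bar> \<le> \<bar>e2\<bar> + (k3 + 1) * \<bar>tan \<zeta>\<bar>"
    "\<bar>e1\<bar> \<le> \<bar>\<gamma>\<bar> + k2 * \<bar>\<delta>\<bar>" "\<bar>e2\<bar> \<le> \<bar>\<theta>\<bar> + (k3 + 1) * \<bar>tan \<zeta>\<bar>"
    using d1 d2 by linarith+
  define S where "S = \<rho> + \<bar>\<delta>\<bar> + \<bar>tan \<zeta>\<bar> + \<bar>e1\<bar> + \<bar>e2\<bar>"
  have V: "lyap_V k2 k3 x = 1 / 2 * (\<rho>\<^sup>2 + \<bar>\<delta>\<bar>\<^sup>2 + \<bar>tan \<zeta>\<bar>\<^sup>2 + \<bar>e1\<bar>\<^sup>2 + \<bar>e2\<bar>\<^sup>2)"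
    by (simp add: xe e1_e2_def)
  \<comment> \<open>The signs of the products left over when \<open>m * S\<close> and
    \<open>m * size_D x\<close> are expanded.\<close>
  have nn: "k2 * \<bar>\<delta>\<bar> \<ge> 0" "k3 * \<bar>tan \<zeta>\<bar> \<ge> 0" "k2 * \<bar>tan \<zeta>\<bar> \<ge> 0" "k3 * \<bar>\<delta>\<bar> \<ge> 0" "k2 * \<rho> \<ge> 0" "k3 * \<rho> \<ge> 0"
    "k2 * \<bar>e1\<bar> \<ge> 0" "k3 * \<bar>e1\<bar> \<ge> 0" "k2 * \<bar>e2\<bar> \<ge> 0" "k3 * \<bar>e2\<bar> \<ge> 0"
    "k2 * \<bar>\<gamma>\<bar> \<ge> 0" "k3 * \<bar>\<gamma>\<bar> \<ge> 0" "k2 * \<bar>\<theta>\<bar> \<ge> 0" "k3 * \<bar>\<theta>\<bar> \<ge> 0"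
    using k \<rho> by simp_all
  have S0: "S \<ge> 0" and size0: "size_D x \<ge> 0" using \<rho> by (simp_all add: S_def xe)
  have "size_D x \<le> \<rho> + (1 + k2) * \<bar>\<delta>\<bar> + \<bar>e1\<bar> + (2 + k3) * \<bar>tan \<zeta>\<bar> + \<bar>e2\<bar>"
    using d by (simp add: xe algebra_simps)
  also have "\<dots> \<le> m * S" using nn \<rho> by (simp add: m_def S_def algebra_simps)
  finally have "(size_D x)\<^sup>2 \<le> (m * S)\<^sup>2" using size0 by (rule power_mono)
  also have "\<dots> = m\<^sup>2 * S\<^sup>2" by (rule power_mult_distrib)
  also have "\<dots> \<le> m\<^sup>2 * (5 * (\<rho>\<^sup>2 + \<bar>\<delta>\<bar>\<^sup>2 + \<bar>tan \<zeta>\<bar>\<^sup>2 + \<bar>e1\<bar>\<^sup>2 + \<bar>e2\<bar>\<^sup>2))"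
    unfolding S_def by (intro mult_left_mono sum5_squares) auto
  finally show "(size_D x)\<^sup>2 \<le> 10 * m\<^sup>2 * lyap_V k2 k3 x" by (simp add: V algebra_simps)
  have "S \<le> \<rho> + (1 + k2) * \<bar>\<delta>\<bar> + \<bar>\<gamma>\<bar> + (2 + k3) * \<bar>tan \<zeta>\<bar> + \<bar>\<theta>\<bar>"
    using d by (simp add: S_def algebra_simps)
  also have "\<dots> \<le> m * size_D x" using nn \<rho> by (simp add: m_def xe algebra_simps)
  finally have "S\<^sup>2 \<le> (m * size_D x)\<^sup>2" using S0 by (rule power_mono)
  moreover have "\<rho>\<^sup>2 + \<bar>\<delta>\<bar>\<^sup>2 + \<bar>tan \<zeta>\<bar>\<^sup>2 + \<bar>e1\<bar>\<^sup>2 + \<bar>e2\<bar>\<^sup>2 \<le> S\<^sup>2"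
    unfolding S_def using \<rho> by (intro squares_le_sum5) auto
  ultimately show "lyap_V k2 k3 x \<le> m\<^sup>2 * (size_D x)\<^sup>2 / 2"
    by (simp add: V power_mult_distrib)
qed

lemma size_D_pos:
  assumes "x \<in> state_Sigma" "x \<noteq> 0"
  shows "size_D x > 0"
proof (rule ccontr)
  assume neg: "\<not> size_D x > 0"
  obtain \<rho> \<delta> \<gamma> \<zeta> \<theta> where xe: "x = (\<rho>, \<delta>, \<gamma>, \<zeta>, \<theta>)" by (cases x)
  have "\<rho> \<ge> 0" "\<bar>\<zeta>\<bar> < pi / 2" using assms by (auto simp: xe state_Sigma_def)
  moreover have "\<rho> + \<bar>\<delta>\<bar> + \<bar>\<gamma>\<bar> + \<bar>tan \<zeta>\<bar> + \<bar>\<theta>\<bar> \<le> 0" using neg by (simp add: xe)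
  ultimately have z: "\<rho> = 0" "\<delta> = 0" "\<gamma> = 0" "\<theta> = 0" "tan \<zeta> = 0" "\<bar>\<zeta>\<bar> < pi / 2" by linarith+
  have "\<zeta> = 0" using arctan_tan_strip[OF z(6)] z(5) by simp
  with z assms(2) show False by (simp add: xe zero_prod_def)
qed

text \<open>Formulated with \<open>sys_rhs_ext\<close> on all of \<open>state_Sigma\<close>, so that
  it also serves the CLF condition at \<open>\<rho> = 0\<close>. The factor of
  \<open>\<rho>\<^sup>2\<close> is at least \<open>k1\<close> because
  \<open>cos \<zeta> \<le> 1\<close>.\<close>

lemma lyap_V_decrease:
  fixes k1 k2 k3 k4 k5 :: real
  assumes k: "k1 > 0" "k2 > 0" "k3 > 0" "k4 > 0" "k5 > 0" and x: "x \<in> state_Sigma"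
  defines "l \<equiv> min k1 (min (k1 * k2) (min (k1 * k3) (min k4 k5)))"
  shows "sys_rhs_ext (k1 * auxN k2 (fst (snd x)) (fst (snd (snd (snd x))))
      * auxB k2 k3 (fst (snd x)) (fst (snd (snd (snd x)))))
      (q_fb k1 k2 k3 k5 x) (rt_fb k1 k2 k3 k4 x) x \<bullet> grad_V k2 k3 x \<le> - (2 * l) * lyap_V k2 k3 x"
proof -
  obtain \<rho> \<delta> \<gamma> \<zeta> \<theta> where xe: "x = (\<rho>, \<delta>, \<gamma>, \<zeta>, \<theta>)" by (cases x)
  have z: "\<bar>\<zeta>\<bar> < pi / 2" using x by (simp add: xe state_Sigma_def)
  have "1 \<le> 1 / cos \<zeta>" using cos_pos_strip[OF z] by simp
  moreover have "k3 * (sin \<zeta>)\<^sup>2 \<ge> 0" using k by simp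
  ultimately have "1 \<le> k3 * (sin \<zeta>)\<^sup>2 + 1 / cos \<zeta>" by linarith
  then have "k1 * \<rho>\<^sup>2 * 1 \<le> k1 * \<rho>\<^sup>2 * (k3 * (sin \<zeta>)\<^sup>2 + 1 / cos \<zeta>)"
    using k by (intro mult_left_mono) auto
  moreover have "l * \<rho>\<^sup>2 \<le> k1 * \<rho>\<^sup>2" "l * \<delta>\<^sup>2 \<le> k1 * k2 * \<delta>\<^sup>2" "l * (tan \<zeta>)\<^sup>2 \<le> k1 * k3 * (tan \<zeta>)\<^sup>2"
    "l * (err1 k2 \<delta> \<gamma> \<zeta>)\<^sup>2 \<le> k4 * (err1 k2 \<delta> \<gamma> \<zeta>)\<^sup>2"
    "l * (err2 k2 k3 \<delta> \<zeta> \<theta>)\<^sup>2 \<le> k5 * (err2 k2 k3 \<delta> \<zeta> \<theta>)\<^sup>2"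
    by (intro mult_right_mono; simp add: l_def)+
  moreover have "2 * l * lyap_V k2 k3 x = l * \<rho>\<^sup>2 + l * \<delta>\<^sup>2 + l * (tan \<zeta>)\<^sup>2
      + l * (err1 k2 \<delta> \<gamma> \<zeta>)\<^sup>2 + l * (err2 k2 k3 \<delta> \<zeta> \<theta>)\<^sup>2"
    by (simp add: xe algebra_simps)
  ultimately show ?thesis
    unfolding xe fst_conv snd_conv grad_V_closed_loop[OF z] by linarith
qed

section \<open>The control Lyapunov property\<close>

lemma strict_CLF_lyap_V:
  fixes k2 k3 :: real
  assumes k: "k2 > 0" "k3 > 0"
  shows "strict_CLF (lyap_V k2 k3)"
proof -
  define m where "m = 2 + k2 + k3"
  have m: "m > 0" using k by (simp add: m_def)
  have K: "class_K (\<lambda>s. a * s\<^sup>2)" if "a > 0" for a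
    using that unfolding class_K_def
    by (auto intro!: continuous_intros strict_mono_onI power_strict_mono)
  note V = lyap_V_bounds[OF k, folded m_def]
  \<comment> \<open>Taking the inner product with a vector depends on it in a bounded linear way, so
    continuity of the derivative reduces to that of \<open>grad_V\<close>.\<close>
  let ?V' = "\<lambda>x. blinfun_inner_left (grad_V k2 k3 x)"
  have strip: "\<bar>fst (snd (snd (snd x)))\<bar> < pi / 2" if "x \<in> state_Sigma" for x
    using that by (auto simp: state_Sigma_def)
  have "isCont (grad_V k2 k3) x" if "x \<in> state_Sigma" for x
    using cos_pos_strip[OF strip[OF that]] by (intro loc_lip_imp_isCont loc_lip_feedback) simp
  then have cont: "continuous_on state_Sigma ?V'"
    by (intro bounded_linear.continuous_on[OF bounded_linear_blinfun_inner_left]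
        continuous_at_imp_continuous_on) blast
  have der: "(lyap_V k2 k3 has_derivative blinfun_apply (?V' x)) (at x within state_Sigma)"
    if "x \<in> state_Sigma" for x
    using lyap_V_has_derivative[OF strip[OF that]] by (auto intro: has_derivative_at_withinI)
  have dec: "\<exists>u q rt. blinfun_apply (?V' x) (sys_rhs_ext u q rt x) < 0" if "x \<in> state_Sigma - {0}" for x
  proof -
    have x: "x \<in> state_Sigma" "size_D x > 0" using that size_D_pos by auto
    then have "0 < (size_D x)\<^sup>2" by simp
    also have "\<dots> \<le> 10 * m\<^sup>2 * lyap_V k2 k3 x" using V(1)[OF x(1)] .
    finally have V0: "lyap_V k2 k3 x > 0" using m by (simp add: zero_less_mult_iff)
    \<comment> \<open>The inputs are the feedback with \<open>k1\<close>, \<open>k4\<close> and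
      \<open>k5\<close> set to 1; this is the corresponding decay rate.\<close>
    have "min 1 (min (1 * k2) (min (1 * k3) (min 1 1))) > 0" using k by simp
    then have "- (2 * min 1 (min (1 * k2) (min (1 * k3) (min 1 1)))) * lyap_V k2 k3 x < 0"
      using V0 by (intro mult_neg_pos) simp_all
    from le_less_trans[OF lyap_V_decrease[OF zero_less_one k zero_less_one zero_less_one x(1)] this]
    show ?thesis unfolding blinfun_inner_left.rep_eq by (intro exI)
  qed
  have \<alpha>: "class_K (\<lambda>s. 1 / (10 * m\<^sup>2) * s\<^sup>2)" "class_K (\<lambda>s. m\<^sup>2 / 2 * s\<^sup>2)"
    using m by (intro K; simp)+
  have bounds: "1 / (10 * m\<^sup>2) * (size_D x)\<^sup>2 \<le> lyap_V k2 k3 x"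
    "lyap_V k2 k3 x \<le> m\<^sup>2 / 2 * (size_D x)\<^sup>2" if "x \<in> state_Sigma" for x
    using V[OF that] m by (simp_all add: field_simps)
  show ?thesis
    unfolding strict_CLF_def
  proof (rule conjI)
    show "\<exists>\<alpha>1 \<alpha>2. class_K \<alpha>1 \<and> class_K \<alpha>2 \<and> (\<forall>\<Theta>\<in>state_Sigma.
        \<alpha>1 (size_D \<Theta>) \<le> lyap_V k2 k3 \<Theta> \<and> lyap_V k2 k3 \<Theta> \<le> \<alpha>2 (size_D \<Theta>))"
      by (rule exI, rule exI, intro conjI ballI, rule \<alpha>(1), rule \<alpha>(2), erule bounds(1), erule bounds(2))
    show "\<exists>V'. (\<forall>\<Theta>\<in>state_Sigma. (lyap_V k2 k3 has_derivative blinfun_apply (V' \<Theta>)) (at \<Theta> within state_Sigma))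
        \<and> continuous_on state_Sigma V'
        \<and> (\<forall>\<Theta>\<in>state_Sigma - {0}. \<exists>u q rt. blinfun_apply (V' \<Theta>) (sys_rhs_ext u q rt \<Theta>) < 0)"
      by (intro exI[of _ ?V'] conjI ballI der cont dec)
  qed
qed

subsection \<open>Exponential stability\<close>

lemma GES_on_D_feedback:
  fixes k1 k2 k3 k4 k5 :: real
  assumes k: "k1 > 0" "k2 > 0" "k3 > 0" "k4 > 0" "k5 > 0"
  shows "GES_on_D (v_fb k1 k2 k3) (q_fb k1 k2 k3 k5) (rt_fb k1 k2 k3 k4)"
proof -
  define v q rt where "v = v_fb k1 k2 k3" "q = q_fb k1 k2 k3 k5" "rt = rt_fb k1 k2 k3 k4"
  note fb = v_q_rt_def
  define f where "f x = sys_rhs (v x) (q x) (rt x) x" for x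
  define m where "m = 2 + k2 + k3"
  define l where "l = min k1 (min (k1 * k2) (min (k1 * k3) (min k4 k5)))"
  define V where "V = lyap_V k2 k3"
  have l: "l > 0" using k by (simp add: l_def)
  have m: "m \<ge> 1" using k by (simp add: m_def)
  have Sigma: "x \<in> state_Sigma" if "x \<in> state_D" for x
    using that by (auto simp: state_D_def state_Sigma_def)
  have strip: "\<bar>fst (snd (snd (snd x)))\<bar> < pi / 2" and \<rho>_pos: "fst x > 0" if "x \<in> state_D" for x
    using that by (auto simp: state_D_def)
  have cos0: "cos (fst (snd (snd (snd x)))) \<noteq> 0" if "x \<in> state_D" for x
    using cos_pos_strip[OF strip[OF that]] by simp
  have lip: "loc_lip f x" if "x \<in> state_D" for x
    unfolding f_def fb using cos0[OF that] \<rho>_pos[OF that]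
    by (intro loc_lip_sys_rhs loc_lip_feedback) auto

  have cont: "continuous_map (Metric_space.mtopology state_D dist_D) euclidean
      (\<lambda>(\<rho>, \<delta>, \<gamma>, \<zeta>, \<theta>).
        (v (\<rho>, \<delta>, \<gamma>, \<zeta>, \<theta>), q (\<rho>, \<delta>, \<gamma>, \<zeta>, \<theta>), rt (\<rho>, \<delta>, \<gamma>, \<zeta>, \<theta>) * cos \<theta>))"
  proof (rule continuous_map_state_D)
    fix x assume "x \<in> state_D"
    then have "loc_lip (\<lambda>x. (v x, q x, rt x * cos (snd (snd (snd (snd x)))))) x"
      unfolding fb by (intro loc_lip_intros loc_lip_feedback cos0)
    then have "isCont (\<lambda>x. (v x, q x, rt x * cos (snd (snd (snd (snd x)))))) x"
      by (rule loc_lip_imp_isCont)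
    then show "isCont (\<lambda>(\<rho>, \<delta>, \<gamma>, \<zeta>, \<theta>).
        (v (\<rho>, \<delta>, \<gamma>, \<zeta>, \<theta>), q (\<rho>, \<delta>, \<gamma>, \<zeta>, \<theta>), rt (\<rho>, \<delta>, \<gamma>, \<zeta>, \<theta>) * cos \<theta>)) x"
      by (simp add: case_prod_unfold)
  qed

  \<comment> \<open>The squared estimate has the factor
    \<open>10 * m\<^sup>2 * m\<^sup>2 / 2 = 5 * m ^ 4\<close>; rounding 5 up to 9 gives the constant
    \<open>3 * m\<^sup>2\<close>, and the rate \<open>2 * l\<close> of \<open>V\<close> halves to
    \<open>l\<close>.\<close>
  have main: "J = {t0..} \<and> (\<forall>t\<ge>t0. size_D (x t) \<le> 3 * m\<^sup>2 * size_D (x t0) * exp (- l * (t - t0)))"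
    if max: "maximal_solution f state_D t0 J x" for t0 J x
  proof -
    have J: "is_interval J" "t0 \<in> J" "J \<subseteq> {t0..}"
      and xD: "\<And>t. t \<in> J \<Longrightarrow> x t \<in> state_D"
      and der: "\<And>t. t \<in> J \<Longrightarrow> (x has_vector_derivative f (x t)) (at t within J)"
      using max by (auto simp: maximal_solution_def solution_on_def)
    have dV: "((\<lambda>t. V (x t)) has_real_derivative f (x t) \<bullet> grad_V k2 k3 (x t)) (at t within J)"
      if "t \<in> J" for t
    proof -
      have "((\<lambda>t. V (x t)) has_derivative (\<lambda>s. (s *\<^sub>R f (x t)) \<bullet> grad_V k2 k3 (x t))) (at t within J)"
        using lyap_V_has_derivative[OF strip[OF xD[OF that]], of k2 k3] der[OF that]
        unfolding V_def has_vector_derivative_def by (rule has_derivative_compose[rotated])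
      then show ?thesis
        by (rule has_derivative_imp_has_field_derivative) (simp add: mult.commute)
    qed
    have V_dec: "f (x t) \<bullet> grad_V k2 k3 (x t) \<le> - (2 * l) * V (x t)" if "t \<in> J" for t
    proof -
      obtain \<rho> \<delta> \<gamma> \<zeta> \<theta> where xe: "x t = (\<rho>, \<delta>, \<gamma>, \<zeta>, \<theta>)" by (cases "x t")
      \<comment> \<open>Positivity of \<open>\<rho>\<close> lets it cancel in
        \<open>v / \<rho>\<close>, so the closed loop takes the extended form.\<close>
      have "\<rho> > 0" using \<rho>_pos[OF xD[OF that]] by (simp add: xe)
      then have "f (x t) = sys_rhs_ext (k1 * auxN k2 \<delta> \<zeta> * auxB k2 k3 \<delta> \<zeta>) (q (x t)) (rt (x t)) (x t)"
        unfolding f_def by (subst sys_rhs_eq_ext) (simp_all add: xe fb)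
      then show ?thesis
        using lyap_V_decrease[OF k Sigma[OF xD[OF that]]] by (simp add: l_def V_def fb xe)
    qed
    have decay: "V (x t) \<le> V (x t0) * exp (- (2 * l) * (t - t0))" if "t \<in> J" for t
      using J that dV V_dec by (intro exp_decay[of J]) auto
    have est: "size_D (x t) \<le> 3 * m\<^sup>2 * size_D (x t0) * exp (- l * (t - t0))" if "t \<in> J" for t
    proof (rule power2_le_imp_le)
      note B = lyap_V_bounds[OF k(2,3) Sigma[OF xD], folded m_def V_def]
      have "(size_D (x t))\<^sup>2 \<le> 10 * m\<^sup>2 * V (x t)" using B(1)[OF that] .
      also have "\<dots> \<le> 10 * m\<^sup>2 * (m\<^sup>2 * (size_D (x t0))\<^sup>2 / 2 * exp (- (2 * l) * (t - t0)))"
        by (intro mult_left_mono order_trans[OF decay[OF that]] mult_right_mono B(2)[OF J(2)]) auto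
      also have "\<dots> = 5 * (m\<^sup>2 * size_D (x t0) * exp (- l * (t - t0)))\<^sup>2"
        by (simp add: power_mult_distrib power2_eq_square[of "exp _"] flip: exp_add)
      also have "\<dots> \<le> 9 * (m\<^sup>2 * size_D (x t0) * exp (- l * (t - t0)))\<^sup>2" by simp
      also have "\<dots> = (3 * m\<^sup>2 * size_D (x t0) * exp (- l * (t - t0)))\<^sup>2"
        by (simp add: power_mult_distrib)
      finally show "(size_D (x t))\<^sup>2 \<le> (3 * m\<^sup>2 * size_D (x t0) * exp (- l * (t - t0)))\<^sup>2" .
      have "size_D (x t0) \<ge> 0"
        using \<rho>_pos[OF xD[OF J(2)]] by (cases "x t0") simp
      then show "0 \<le> 3 * m\<^sup>2 * size_D (x t0) * exp (- l * (t - t0))" by simp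
    qed

    define R where "R = 3 * m\<^sup>2 * size_D (x t0)"
    have R0: "R \<ge> 0" using \<rho>_pos[OF xD[OF J(2)]] unfolding R_def by (cases "x t0") simp
    have size_R: "size_D (x t) \<le> R" if "t \<in> J" for t
    proof -
      have "R * exp (- l * (t - t0)) \<le> R"
        using J(3) that l R0 by (intro mult_left_le) auto
      then show ?thesis using est[OF that] by (simp add: R_def)
    qed
    \<comment> \<open>The bound on \<open>tan \<zeta>\<close> confines \<open>\<zeta>\<close> to a
      closed interval strictly inside the strip; the parameter \<open>r\<close> is a lower limit for
      \<open>\<rho>\<close>, and the box lies in \<open>state_D\<close> once
      \<open>r > 0\<close>.\<close>
    define box where "box r = {r..R} \<times> {- R..R} \<times> {- R..R} \<times> {- arctan R..arctan R} \<times> {- R..R}" for r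
    have box: "compact (box r)" for r unfolding box_def by (intro compact_Times compact_Icc)
    have in_box: "x t \<in> box r" if "t \<in> J" "r \<le> fst (x t)" for t r
    proof -
      obtain \<rho> \<delta> \<gamma> \<zeta> \<theta> where xe: "x t = (\<rho>, \<delta>, \<gamma>, \<zeta>, \<theta>)" by (cases "x t")
      have \<rho>: "\<rho> > 0" and z: "\<bar>\<zeta>\<bar> < pi / 2"
        using \<rho>_pos[OF xD[OF that(1)]] strip[OF xD[OF that(1)]] by (simp_all add: xe)
      then have b: "\<rho> \<le> R" "\<bar>\<delta>\<bar> \<le> R" "\<bar>\<gamma>\<bar> \<le> R" "\<bar>tan \<zeta>\<bar> \<le> R" "\<bar>\<theta>\<bar> \<le> R"
        using size_R[OF that(1)] by (simp_all add: xe)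
      have "arctan \<bar>tan \<zeta>\<bar> \<le> arctan R" using b(4) by (rule arctan_monotone')
      then have "\<bar>\<zeta>\<bar> \<le> arctan R" using arctan_tan_strip[OF z] by (simp flip: abs_arctan)
      then show ?thesis using b that(2) by (simp add: box_def xe abs_le_iff)
    qed
    have box_strip: "\<bar>fst (snd (snd (snd y)))\<bar> < pi / 2" if "y \<in> box r" for y r
      using that arctan_bounded[of R] by (auto simp: box_def abs_less_iff)

    \<comment> \<open>This is the logarithmic derivative of \<open>\<rho>\<close> along the closed
      loop. It remains continuous at \<open>\<rho> = 0\<close>, so it is bounded on the compact set
      \<open>box 0\<close> before any positive lower limit is known.\<close>
    define g where "g y = k1 * auxN k2 (fst (snd y)) (fst (snd (snd (snd y))))
      * auxB k2 k3 (fst (snd y)) (fst (snd (snd (snd y))))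
      * (sin (snd (snd (snd (snd y)))) * sin (fst (snd (snd (snd y))))
        - cos (snd (snd (snd (snd y)))) * cos (fst (snd (snd (snd y)))) * cos (fst (snd (snd y))))"
      for y :: state
    have "loc_lip g y" if "y \<in> box 0" for y
      unfolding g_def using cos_pos_strip[OF box_strip[OF that]] by (intro loc_lip_fb_intros) auto
    then have "continuous_on (box 0) g"
      by (intro continuous_at_imp_continuous_on) (blast intro: loc_lip_imp_isCont)
    then have "compact (g ` box 0)" using box by (rule compact_continuous_image)
    then obtain M where M: "M > 0" "\<And>y. y \<in> box 0 \<Longrightarrow> \<bar>g y\<bar> \<le> M"
      by (metis bounded_pos compact_imp_bounded imageI real_norm_def)
    have d\<rho>: "((\<lambda>t. - fst (x t)) has_real_derivative - (fst (x t) * g (x t))) (at t within J)"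
      if "t \<in> J" for t
    proof -
      have "fst (f (x t)) = fst (x t) * g (x t)"
        by (cases "x t") (simp add: f_def fb g_def)
      moreover have "((\<lambda>t. fst (x t)) has_vector_derivative fst (f (x t))) (at t within J)"
        using der[OF that] by (rule bounded_linear.has_vector_derivative[OF bounded_linear_fst])
      ultimately show ?thesis
        by (auto simp: has_real_derivative_iff_has_vector_derivative intro: has_vector_derivative_minus)
    qed
    have \<rho>_lower: "fst (x t0) * exp (- M * (t - t0)) \<le> fst (x t)" if "t \<in> J" for t
    proof -
      have "- (fst (x t) * g (x t)) \<le> - M * - fst (x t)" if "t \<in> J" for t
      proof -
        have pos: "fst (x t) > 0" using \<rho>_pos[OF xD[OF that]] .
        have "- g (x t) \<le> M" using M(2)[OF in_box[OF that, of 0]] pos by auto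
        then have "fst (x t) * - g (x t) \<le> fst (x t) * M" using pos by (intro mult_left_mono) auto
        then show ?thesis by (simp add: mult.commute)
      qed
      \<comment> \<open>The exponential estimate is applied to \<open>- \<rho>\<close> with rate
        \<open>M\<close>, so the upper bound becomes a lower bound on \<open>\<rho>\<close>.\<close>
      then have "- fst (x t) \<le> - fst (x t0) * exp (- M * (t - t0))"
        using J that d\<rho> by (intro exp_decay[of J]) auto
      then show ?thesis by simp
    qed
    have conf: "\<exists>K. compact K \<and> K \<subseteq> state_D \<and> (\<forall>t\<in>J. t \<le> T \<longrightarrow> x t \<in> K)" if "T \<ge> t0" for T
    proof (intro exI conjI ballI impI)
      \<comment> \<open>The lower bound decreases in time, so its value at \<open>T\<close> works
        for all earlier times.\<close>
      define r where "r = fst (x t0) * exp (- M * (T - t0))"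
      have "r > 0" using \<rho>_pos[OF xD[OF J(2)]] by (simp add: r_def)
      then show "box r \<subseteq> state_D"
        using box_strip[of _ r] by (auto simp: state_D_def box_def)
      show "x t \<in> box r" if "t \<in> J" "t \<le> T" for t
      proof (rule in_box[OF that(1)])
        have "r \<le> fst (x t0) * exp (- M * (t - t0))"
          unfolding r_def using that M(1) \<rho>_pos[OF xD[OF J(2)]]
          by (intro mult_left_mono) (auto intro!: mult_left_mono)
        then show "r \<le> fst (x t)" using \<rho>_lower[OF that(1)] by linarith
      qed
      show "compact (box r)" by (rule box)
    qed
    have "J = {t0..}" by (rule maximal_solution_global[OF open_state_D lip max conf])
    then show ?thesis using est by auto
  qed
  have "3 * m\<^sup>2 \<ge> 1" using one_le_power[OF m, of 2] by linarith
  then have "\<exists>K\<ge>1. \<exists>c>0. \<forall>t0 J x. maximal_solution f state_D t0 J x \<longrightarrow>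
      J = {t0..} \<and> (\<forall>t\<ge>t0. size_D (x t) \<le> K * size_D (x t0) * exp (- c * (t - t0)))"
    using main l by blast
  with cont show ?thesis unfolding GES_on_D_def f_def[abs_def] fb by (intro conjI)
qed

theorem theorem1:
  fixes k1 k2 k3 k4 k5 :: real
  assumes "k1 > 0" "k2 > 0" "k3 > 0" "k4 > 0" "k5 > 0"
  shows "GES_on_D (v_fb k1 k2 k3) (q_fb k1 k2 k3 k5) (rt_fb k1 k2 k3 k4)
         \<and> strict_CLF (lyap_V k2 k3)"
  using assms by (intro conjI GES_on_D_feedback strict_CLF_lyap_V)

end
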